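(* Let $V$ be an $n$-dimensional vector space over $\mathbb{F}_q$, $2\le k\le n/2$, let $\mathcal{F}$ be a covering-triple-free family of $k$-dimensional subspaces of $V$, and fix $A\in\mathcal{F}$. Then for every integer $1\le i\le k/2$, $$|\mathcal{F}_i| + |\mathcal{F}_{k-i}| \le q^{(k-i)^2}\begin{bmatrix} n-k \\ k-i\end{bmatrix}_q\begin{bmatrix} k-1 \\ i-1\end{bmatrix}_q + q^{i^2}\begin{bmatrix} n-k \\ i\end{bmatrix}_q\begin{bmatrix} k-1 \\ i\end{bmatrix}_q.$$ If equality holds, then $|\phi_A^{-1}(D)|\ge\begin{bmatrix} k-1 \\ i\end{bmatrix}_q$ for every $i$-dimensional subspace $D$ of $V$ with $D\cap A=\{0\}$, $\mathcal{F}^\star=\emptyset$, and $|\phi_A(B)| = q^{i(k-i)}$ for all $B\in\mathcal{F}_i\cup\mathcal{F}_{k-i}$.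
   Context: Three distinct $k$-dimensional subspaces $A,B,C$ form a covering triple if $A=(A\cap B)\oplus(A\cap C)$; a family is covering-triple-free if no three distinct members form a covering triple. Let $\mathcal{F}^\star$ be the set of members of $\mathcal{F}$ whose intersection with every other member of $\mathcal{F}$ is $\{0\}$. With $A\in\mathcal{F}$ fixed, for $B \in \mathcal{F}\setminus\mathcal{F}^\star$ define $i_A(B) = \dim(A\cap B)$ if $A\cap B\ne\{0\}$, and $i_A(B) = \min\{\dim(B\cap C) : C\in\mathcal{F},\ B\cap C\ne\{0\}\}$ if $A\cap B=\{0\}$. Define $\mathcal{I}_A(B) = \{A\}$ if $A\cap B\ne\{0\}$, and $\mathcal{I}_A(B)=\{C\in\mathcal{F} : \dim(B\cap C) = i_A(B)\}$ if $A\cap B=\{0\}$. For $B\in\mathcal{F}$: if $B\notin\mathcal{F}^\star$, $\phi_A(B)$ is the set of $(k-i_A(B))$-dimensional subspaces $D$ of $B$ for which some $C\in\mathcal{I}_A(B)$ has $D\cap C=\{0\}$; if $B\in\mathcal{F}^\star$, $\phi_A(B)$ is the set of all subspaces of $B$. For a subspace $D$ with $D\cap A=\{0\}$, $\phi_A^{-1}(D)=\{B\in\mathcal{F} : D\in\phi_A(B)\}$. For $1\le j\le k-1$, $\mathcal{F}_j = \{B\in\mathcal{F}\setminus\mathcal{F}^\star : i_A(B)=j\}\cup\mathcal{F}^\star$. $\begin{bmatrix} m \\ j\end{bmatrix}_q$ is the Gaussian binomial coefficient. *)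

theory Defs
  imports Complex_Main "HOL-Library.Cardinality"
begin

text \<open>
  The factors in the numerator with \<open>t \<ge> m\<close> vanish (truncated subtraction in the exponent),
  so the value is \<open>0\<close> for \<open>j > m\<close>.
\<close>
definition gauss_binomial :: "nat \<Rightarrow> nat \<Rightarrow> nat \<Rightarrow> real" where
  "gauss_binomial q m j = (\<Prod>t<j. (real q ^ (m - t) - 1) / (real q ^ (j - t) - 1))"

definition is_direct_sum :: "'b::ab_group_add set \<Rightarrow> 'b set \<Rightarrow> 'b set \<Rightarrow> bool" where
  "is_direct_sum U S T \<longleftrightarrow> U = {x + y | x y. x \<in> S \<and> y \<in> T} \<and> S \<inter> T = {0}"

text \<open>
  The vector space structure is passed explicitly as the scalar multiplication \<open>scale\<close>; the
  notions below are meant for \<open>vector_space scale\<close>.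
\<close>
type_synonym ('a, 'b) scaling = "'a \<Rightarrow> 'b \<Rightarrow> 'b"

definition dim_subspace ::
    "('a::field, 'b::ab_group_add) scaling \<Rightarrow> nat \<Rightarrow> 'b set \<Rightarrow> bool" where
  "dim_subspace scale k S \<longleftrightarrow> module.subspace scale S \<and> vector_space.dim scale S = k"

definition covering_triple ::
    "('a::field, 'b::ab_group_add) scaling \<Rightarrow> nat \<Rightarrow> 'b set \<Rightarrow> 'b set \<Rightarrow> 'b set \<Rightarrow> bool" where
  "covering_triple scale k A B C \<longleftrightarrow>
     dim_subspace scale k A \<and> dim_subspace scale k B \<and> dim_subspace scale k C \<and>
     A \<noteq> B \<and> A \<noteq> C \<and> B \<noteq> C \<and> is_direct_sum A (A \<inter> B) (A \<inter> C)"

text \<open>\<open>covering_triple\<close> is not symmetric in its arguments; all orderings are excluded.\<close>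
definition covering_triple_free ::
    "('a::field, 'b::ab_group_add) scaling \<Rightarrow> nat \<Rightarrow> 'b set set \<Rightarrow> bool" where
  "covering_triple_free scale k F \<longleftrightarrow>
     (\<forall>A\<in>F. \<forall>B\<in>F. \<forall>C\<in>F. \<not> covering_triple scale k A B C)"

text \<open>The subfamily \<open>\<F>\<^sup>\<star>\<close>.\<close>
definition isolated_members :: "'b::zero set set \<Rightarrow> 'b set set" where
  "isolated_members F = {B \<in> F. \<forall>C\<in>F. C \<noteq> B \<longrightarrow> B \<inter> C = {0}}"

text \<open>
  \<open>meet_index scale F A B\<close> is \<open>i\<^sub>A(B)\<close> and \<open>meet_partners scale F A B\<close> is \<open>\<I>\<^sub>A(B)\<close>. Both are
  meaningful only for \<open>B \<in> F - isolated_members F\<close>; such a \<open>B\<close> meets another member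
  nontrivially, so admitting \<open>C = B\<close> in the minimum does not change it.
\<close>
definition meet_index ::
    "('a::field, 'b::ab_group_add) scaling \<Rightarrow> 'b set set \<Rightarrow> 'b set \<Rightarrow> 'b set \<Rightarrow> nat" where
  "meet_index scale F A B =
     (if A \<inter> B \<noteq> {0} then vector_space.dim scale (A \<inter> B)
      else Min {vector_space.dim scale (B \<inter> C) | C. C \<in> F \<and> B \<inter> C \<noteq> {0}})"

definition meet_partners ::
    "('a::field, 'b::ab_group_add) scaling \<Rightarrow> 'b set set \<Rightarrow> 'b set \<Rightarrow> 'b set \<Rightarrow> 'b set set" where
  "meet_partners scale F A B =
     (if A \<inter> B \<noteq> {0} then {A}
      else {C \<in> F. vector_space.dim scale (B \<inter> C) = meet_index scale F A B})"

definition phi ::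
    "('a::field, 'b::ab_group_add) scaling \<Rightarrow> nat \<Rightarrow> 'b set set \<Rightarrow> 'b set \<Rightarrow> 'b set \<Rightarrow> 'b set set" where
  "phi scale k F A B =
     (if B \<in> isolated_members F then {D. module.subspace scale D \<and> D \<subseteq> B}
      else {D. dim_subspace scale (k - meet_index scale F A B) D \<and> D \<subseteq> B \<and>
               (\<exists>C \<in> meet_partners scale F A B. D \<inter> C = {0})})"

definition phi_inv ::
    "('a::field, 'b::ab_group_add) scaling \<Rightarrow> nat \<Rightarrow> 'b set set \<Rightarrow> 'b set \<Rightarrow> 'b set \<Rightarrow> 'b set set" where
  "phi_inv scale k F A D = {B \<in> F. D \<in> phi scale k F A B}"

text \<open>The subfamily \<open>\<F>\<^sub>j\<close>; it always contains \<open>\<F>\<^sup>\<star>\<close>.\<close>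
definition index_class ::
    "('a::field, 'b::ab_group_add) scaling \<Rightarrow> 'b set set \<Rightarrow> 'b set \<Rightarrow> nat \<Rightarrow> 'b set set" where
  "index_class scale F A j =
     {B \<in> F - isolated_members F. meet_index scale F A B = j} \<union> isolated_members F"

end

theory Submission
  imports Defs "HOL-Algebra.Algebraic_Closure_Type"
begin

text \<open>
  Fix a subspace \<open>D\<close> with \<open>D \<inter> A = {0}\<close> and \<open>dim D = k - j\<close>. Unless \<open>phi_inv D\<close> consists of a single
  isolated member, all \<open>B\<close> in it have a common partner \<open>C \<in> F\<close> with \<open>B = D \<oplus> (B \<inter> C)\<close>, and since no
  \<open>B\<close> is covered by \<open>C\<close> and another \<open>B'\<close>, the traces \<open>B \<inter> C\<close> form an intersecting family of
  \<open>j\<close>-dimensional subspaces of \<open>C\<close>. For \<open>2 * j \<le> k\<close> the Erdos-Ko-Rado theorem bounds its size by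
  the number of subspaces through a fixed line. For \<open>2 * j > k\<close> that bound can fail, but if \<open>D \<subseteq> D'\<close>
  with \<open>dim D = i\<close> and \<open>dim D' = k - i\<close>, then the traces of both families on one and the same \<open>C\<close>
  cross-intersect, and a large \<open>phi_inv D\<close> forces a small \<open>phi_inv D'\<close>. Averaging over all such
  pairs \<open>D \<subseteq> D'\<close> and dividing by \<open>q ^ (i * (k - i))\<close>, a lower bound for the size of \<open>phi B\<close>, gives
  the theorem when \<open>A\<close> meets another member.

  If \<open>A\<close> is isolated it belongs to both classes but contains no admissible \<open>D\<close>, so one has to gain
  slightly more: every subspace of a member \<open>Z\<close> outside \<open>phi Z\<close> has empty \<open>phi_inv\<close>, and if there
  are few such subspaces then some hyperplane through \<open>A\<close> contains none of them, and counting inside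
  it yields a strictly better bound.

  The cross-intersection bound comes from the multiplication of the field extension of degree
  \<open>dim E\<close>, which splits the complements of \<open>E\<close> into classes of pairwise disjoint subspaces. Together
  with the spectral gap of the inclusion relation between consecutive Grassmannians it also gives the
  Erdos-Ko-Rado theorem.
\<close>

section \<open>Finite extension fields\<close>

lemma finite_field_card_gt_1: "CARD('a::{field,finite}) > 1"
proof -
  have "card {0::'a, 1} \<le> CARD('a)" by (rule card_mono) auto
  thus ?thesis by simp
qed

text \<open>Multiplication by \<open>x \<noteq> 0\<close> permutes the nonzero elements; comparing
  the products over them cancels to \<open>x ^ (q - 1) = 1\<close>.\<close>

lemma finite_field_power_card:
  fixes x :: "'a::{field,finite}"
  shows "x ^ CARD('a) = x"
proof (cases "x = 0")
  case False
  have "x * (\<Prod>y\<in>UNIV-{0}. x * y) = x * x ^ (CARD('a) - 1) * \<Prod>(UNIV-{0})"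
    by (simp add: prod.distrib mult_ac)
  also have "x * x ^ (CARD('a) - 1) = x ^ CARD('a)"
    by (metis finite_UNIV_card_ge_0 finite power_eq_if not_gr_zero)
  also have "(\<Prod>y\<in>UNIV-{0}. x * y) = (\<Prod>y\<in>UNIV-{0}. y)"
    by (rule prod.reindex_bij_witness[of _ "\<lambda>y. y / x" "\<lambda>y. x * y"]) (use False in auto)
  finally show ?thesis by simp
qed (use finite_UNIV_card_ge_0[where ?'a = 'a] in auto)

text \<open>A polynomial of degree below \<open>q\<close> vanishing on all of the field is zero; applied to
  \<open>(X + 1) ^ q - X ^ q - 1\<close> this gives the divisibility without knowing that \<open>q\<close> is a prime power.\<close>
lemma of_nat_card_choose_eq_0:
  assumes "0 < j" "j < CARD('a::{field,finite})"
  shows "of_nat (CARD('a) choose j) = (0::'a)"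
proof -
  let ?q = "CARD('a)"
  define P :: "'a poly" where "P = [:1, 1:] ^ ?q - monom 1 ?q - 1"
  have q1: "?q > 1" by (rule finite_field_card_gt_1)
  have coeff: "coeff ([:1, 1:] ^ ?q) t = (of_nat (?q choose t) :: 'a)" if "t \<le> ?q" for t
    using that coeff_linear_poly_power[of t ?q "1::'a" 1] by simp
  have deg: "degree ([:1, 1::'a:] ^ ?q) = ?q" by (simp add: degree_power_eq)
  have "degree P < ?q"
  proof -
    have "coeff P t = 0" if "t \<ge> ?q" for t
    proof (cases "t = ?q")
      case True then show ?thesis using coeff[of ?q] q1 by (simp add: P_def)
    next
      case False
      with that have "t > ?q" by simp
      then show ?thesis using deg q1 by (simp add: P_def coeff_eq_0)
    qed
    then show ?thesis using q1 by (metis degree_lessI gr_zeroI not_less_zero)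
  qed
  moreover have "{x. poly P x = 0} = UNIV"
    by (auto simp: P_def poly_monom finite_field_power_card poly_power)
  ultimately have "P = 0"
    using card_poly_roots_bound[of P] by fastforce
  then have "coeff P j = 0" by simp
  with coeff[of j] assms show ?thesis by (simp add: P_def)
qed

lemma alg_closure_of_nat_eq_0:
  "of_nat m = (0::'a::field) \<Longrightarrow> of_nat m = (0::'a alg_closure)"
  by (metis to_ac_of_nat to_ac_0)

text \<open>The inner binomial coefficients vanish in the ground field, hence in its closure.
  Additivity makes the fixed points of this power map closed under addition.\<close>

lemma alg_closure_add_power_card:
  fixes x y :: "'a::{field,finite} alg_closure"
  shows "(x + y) ^ (CARD('a) ^ m) = x ^ (CARD('a) ^ m) + y ^ (CARD('a) ^ m)"
proof (induction m)
  case (Suc m)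
  let ?q = "CARD('a)"
  have q1: "?q > 1" by (rule finite_field_card_gt_1)
  have *: "(x + y) ^ ?q = x ^ ?q + y ^ ?q" for x y :: "'a alg_closure"
  proof -
    have "(x + y) ^ ?q = (\<Sum>j\<le>?q. of_nat (?q choose j) * x ^ j * y ^ (?q - j))"
      by (rule binomial_ring)
    also have "\<dots> = (\<Sum>j\<in>{0, ?q}. of_nat (?q choose j) * x ^ j * y ^ (?q - j))"
      using of_nat_card_choose_eq_0[where 'a='a, THEN alg_closure_of_nat_eq_0]
      by (intro sum.mono_neutral_right) (auto simp: le_less)
    finally show ?thesis using q1 by (auto simp: add.commute)
  qed
  show ?case
    unfolding power_Suc by (simp only: mult.commute[of ?q] power_mult Suc.IH *)
qed simp

text \<open>The polynomial \<open>X ^ n - X\<close> splits in the closure and has derivative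
  \<open>-1\<close>, so its roots are distinct. They form the extension field of degree
  \<open>m\<close>.\<close>

lemma card_alg_closure_power_fixpoints:
  assumes "m > 0"
  shows "card {x::'a::{field,finite} alg_closure. x ^ (CARD('a) ^ m) = x} = CARD('a) ^ m"
proof -
  let ?n = "CARD('a) ^ m"
  have n1: "?n > 1" using finite_field_card_gt_1[where 'a='a] assms one_less_power by blast
  define p :: "'a alg_closure poly" where "p = monom 1 ?n - [:0, 1:]"
  have deg: "degree p = ?n"
  proof (rule antisym)
    show "degree p \<le> ?n" unfolding p_def using n1 by (intro degree_diff_le) (auto simp: degree_monom_eq)
    show "?n \<le> degree p" using n1 assms finite_field_card_gt_1[where 'a='a]
      by (intro le_degree) (simp add: p_def coeff_pCons split: nat.splits)
  qed
  have p0: "p \<noteq> 0" using deg n1 by auto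
  have "of_nat CARD('a) = (0::'a)"
    using of_nat_card_choose_eq_0[of 1, where 'a='a] finite_field_card_gt_1[where 'a='a] by simp
  then have "of_nat ?n = (0::'a alg_closure)"
    using assms by (metis alg_closure_of_nat_eq_0 of_nat_power power_0_left neq0_conv)
  moreover have "pderiv p = monom (of_nat ?n) (?n - 1) - 1"
    by (simp add: p_def pderiv_diff pderiv_monom pderiv_pCons one_pCons del: of_nat_power)
  ultimately have pd: "pderiv p = -1" by (simp del: of_nat_power)
  obtain A c where A: "size A = degree p" "p = smult c (\<Prod>x\<in>#A. [:- x, 1:])"
    using alg_closed_imp_factorization[OF p0] by blast
  have "c \<noteq> 0" using p0 A(2) by auto
  then have roots: "{x. poly p x = 0} = set_mset A"
    unfolding A(2) by (auto simp: poly_prod_mset)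
  have "count A x \<le> 1" for x
  proof (rule ccontr)
    assume "\<not> count A x \<le> 1"
    then have "count A x \<ge> 2" by simp
    then have "{#x, x#} \<subseteq># A" by (auto simp: subseteq_mset_def)
    then obtain B where "A = {#x, x#} + B" by (metis mset_subset_eq_exists_conv)
    then have "p = [:-x, 1:] * ([:-x, 1:] * smult c (\<Prod>x\<in>#B. [:- x, 1:]))"
      using A(2) by (simp add: mult_ac)
    then have "poly (pderiv p) x = 0"
      by (elim ssubst) (simp only: pderiv_mult poly_add poly_mult poly_pCons, simp)
    with pd show False by simp
  qed
  then have "A = mset_set (set_mset A)"
    by (intro multiset_eqI) (simp add: count_mset_set' le_antisym Suc_le_eq not_in_iff)
  then have "card (set_mset A) = size A" by (metis size_mset_set)
  moreover have "{x. poly p x = 0} = {x. x ^ ?n = x}"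
    by (auto simp: p_def poly_monom)
  ultimately show ?thesis using A(1) deg roots by simp
qed

section \<open>Gaussian binomial coefficients\<close>

lemma gauss_binomial_0 [simp]: "gauss_binomial q m 0 = 1"
  by (simp add: gauss_binomial_def)

lemma gauss_binomial_Suc_Suc:
  "gauss_binomial q (Suc m) (Suc j) =
     (real q ^ Suc m - 1) / (real q ^ Suc j - 1) * gauss_binomial q m j"
  unfolding gauss_binomial_def by (subst prod.lessThan_Suc_shift) simp

lemma gauss_binomial_nonneg: "q > 0 \<Longrightarrow> gauss_binomial q m j \<ge> 0"
  unfolding gauss_binomial_def by (intro prod_nonneg divide_nonneg_nonneg) auto

lemma gauss_binomial_self: "q > 1 \<Longrightarrow> gauss_binomial q m m = 1"
proof (induction m)
  case (Suc m)
  have "real q ^ Suc m \<noteq> 1" using Suc.prems one_less_power[of "real q" "Suc m"] by simp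
  with Suc show ?case by (simp add: gauss_binomial_Suc_Suc del: power_Suc)
qed simp

lemma gauss_binomial_1: "gauss_binomial q m 1 = (real q ^ m - 1) / (real q - 1)"
  by (simp add: gauss_binomial_def)

context
  fixes q :: nat
  assumes q: "q > 1"
begin

private lemma qpow_gt_1: "real q ^ Suc j > 1"
  using q by (intro one_less_power) auto

lemma gauss_binomial_step:
  "j \<le> m \<Longrightarrow> gauss_binomial q m (Suc j) * (real q ^ Suc j - 1) =
     gauss_binomial q m j * (real q ^ (m - j) - 1)"
proof (induction m arbitrary: j)
  case (Suc m)
  show ?case
  proof (cases j)
    case 0
    then show ?thesis using qpow_gt_1[of 0] by (simp add: gauss_binomial_Suc_Suc)
  next
    case (Suc j')
    have "gauss_binomial q (Suc m) (Suc j) * (real q ^ Suc j - 1) = (real q ^ Suc m - 1) * gauss_binomial q m (Suc j')"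
      using Suc qpow_gt_1[of j] by (simp add: gauss_binomial_Suc_Suc del: power_Suc)
    also have "\<dots> = (real q ^ Suc m - 1) * (gauss_binomial q m j' * (real q ^ (m - j') - 1) / (real q ^ Suc j' - 1))"
      using Suc.IH[of j'] Suc.prems Suc qpow_gt_1[of j'] by (simp add: eq_divide_eq del: power_Suc)
    finally show ?thesis
      using Suc by (simp add: gauss_binomial_Suc_Suc mult_ac del: power_Suc)
  qed
qed (use qpow_gt_1[of 0] in \<open>simp add: gauss_binomial_def\<close>)

lemma gauss_binomial_Pascal1:
  assumes "j \<le> m"
  shows "gauss_binomial q (Suc m) (Suc j) =
    real q ^ Suc j * gauss_binomial q m (Suc j) + gauss_binomial q m j"
proof -
  have "gauss_binomial q m (Suc j) = gauss_binomial q m j * (real q ^ (m - j) - 1) / (real q ^ Suc j - 1)"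
    using gauss_binomial_step[OF assms] qpow_gt_1[of j] by (simp add: field_simps)
  moreover have "real q ^ Suc m = real q ^ Suc j * real q ^ (m - j)"
    using assms by (simp flip: power_add)
  ultimately show ?thesis
    using qpow_gt_1[of j] by (simp add: gauss_binomial_Suc_Suc field_simps del: power_Suc)
qed

lemma gauss_binomial_Pascal2:
  assumes "j \<le> m"
  shows "gauss_binomial q (Suc m) (Suc j) =
    gauss_binomial q m (Suc j) + real q ^ (m - j) * gauss_binomial q m j"
proof -
  have "gauss_binomial q m (Suc j) = gauss_binomial q m j * (real q ^ (m - j) - 1) / (real q ^ Suc j - 1)"
    using gauss_binomial_step[OF assms] qpow_gt_1[of j] by (simp add: field_simps)
  moreover have "real q ^ Suc m = real q ^ Suc j * real q ^ (m - j)"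
    using assms by (simp flip: power_add)
  ultimately show ?thesis
    using qpow_gt_1[of j] by (simp add: gauss_binomial_Suc_Suc field_simps del: power_Suc)
qed

lemma gauss_binomial_symmetric:
  "j \<le> m \<Longrightarrow> gauss_binomial q m j = gauss_binomial q m (m - j)"
proof (induction m arbitrary: j)
  case (Suc m)
  show ?case
  proof (cases "j = 0 \<or> j = Suc m")
    case False
    then obtain j' where j': "j = Suc j'" "j' < m" using Suc.prems by (cases j) auto
    then have "Suc m - j = Suc (m - Suc j')" by simp
    then have "gauss_binomial q (Suc m) (Suc m - j) =
        gauss_binomial q m (m - j') + real q ^ j * gauss_binomial q m (m - Suc j')"
      using gauss_binomial_Pascal2[of "m - Suc j'" m] j' by (simp add: Suc_diff_Suc)
    also have "\<dots> = gauss_binomial q (Suc m) j"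
      using gauss_binomial_Pascal1[of j' m] Suc.IH[of j'] Suc.IH[of "Suc j'"] j' by simp
    finally show ?thesis by simp
  qed (use q in \<open>auto simp: gauss_binomial_self\<close>)
qed simp

text \<open>Only the term with factor \<open>q ^ j\<close> of Pascal's rule is kept at each step.
  The bound is the number of complements of a fixed subspace of codimension
  \<open>j\<close>.\<close>

lemma gauss_binomial_ge_power:
  "j \<le> m \<Longrightarrow> gauss_binomial q m j \<ge> real q ^ (j * (m - j))"
proof (induction m arbitrary: j)
  case (Suc m)
  show ?case
  proof (cases "j = 0 \<or> j = Suc m")
    case False
    then obtain j' where j': "j = Suc j'" "j' < m" using Suc.prems by (cases j) auto
    have "Suc m - j = Suc (m - j)" using j' by simp
    then have "real q ^ (j * (Suc m - j)) = real q ^ j * real q ^ (j * (m - j))"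
      by (simp only: mult_Suc_right power_add)
    also have "\<dots> \<le> real q ^ j * gauss_binomial q m j"
      using Suc.IH[of j] j' by (intro mult_left_mono) auto
    also have "\<dots> \<le> gauss_binomial q (Suc m) j"
      using gauss_binomial_Pascal1[of j' m] gauss_binomial_nonneg[of q m j'] q j' by simp
    finally show ?thesis .
  qed (use q in \<open>auto simp: gauss_binomial_self\<close>)
qed simp

lemma gauss_binomial_ge_1: "j \<le> m \<Longrightarrow> gauss_binomial q m j \<ge> 1"
  using gauss_binomial_ge_power[of j m] q one_le_power[of "real q" "j * (m - j)"] by linarith

lemma gauss_binomial_mono:
  assumes "m \<le> m'" "j \<le> m"
  shows "gauss_binomial q m j \<le> gauss_binomial q m' j"
  using assms(1)
proof (induction rule: dec_induct)
  case (step m')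
  show ?case
  proof (cases j)
    case (Suc j')
    then have "gauss_binomial q m' j \<le> gauss_binomial q (Suc m') j"
      using gauss_binomial_Pascal2[of j' m'] gauss_binomial_nonneg[of q m' j'] step assms q by simp
    with step show ?thesis by simp
  qed simp
qed simp

end

lemma double_count:
  assumes "finite A" "finite B"
  shows "(\<Sum>a\<in>A. card {b\<in>B. R a b}) = (\<Sum>b\<in>B. card {a\<in>A. R a b})"
proof -
  have "(\<Sum>a\<in>A. card {b\<in>B. R a b}) = (\<Sum>a\<in>A. \<Sum>b | b \<in> B \<and> R a b. 1)" by simp
  also have "\<dots> = (\<Sum>b\<in>B. \<Sum>a | a \<in> A \<and> R a b. 1)"
    by (rule sum.swap_restrict[OF assms])
  finally show ?thesis by simp
qed

section \<open>Vector spaces over a finite field\<close>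

text \<open>Separate from the finite-dimensional locale so that the algebraic closure of the scalars
  can also be treated as such a space.\<close>

locale finite_field_vector_space = vector_space scale
  for scale :: "'a::{field,finite} \<Rightarrow> 'b::ab_group_add \<Rightarrow> 'b" (infixr "*s" 75) +
  fixes q :: nat
  assumes q_eq: "q = CARD('a)"
begin

lemma q_gt_1: "q > 1"
  unfolding q_eq by (rule finite_field_card_gt_1)

text \<open>Adjoining \<open>b\<close> multiplies the size by \<open>q\<close>, as each vector of
  the larger span is \<open>c *s b + x\<close> for exactly one pair.\<close>

lemma card_span_independent:
  assumes "finite B" "independent B"
  shows "finite (span B) \<and> card (span B) = q ^ card B"
  using assms
proof (induction B rule: finite_induct)
  case (insert b B)
  then have b: "b \<notin> span B" and ind: "independent B"
    by (auto simp: independent_insert)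
  let ?f = "\<lambda>(c, x). c *s b + x"
  have inj: "inj_on ?f (UNIV \<times> span B)"
  proof (rule inj_onI, clarify)
    fix c d x y assume x: "x \<in> span B" and y: "y \<in> span B" and eq: "c *s b + x = d *s b + y"
    then have "(c - d) *s b = y - x" by (simp add: algebra_simps)
    then have "(c - d) *s b \<in> span B" using x y by (simp add: span_diff)
    then have "c - d = 0"
      using b by (metis span_scale scale_scale left_inverse scale_one)
    with eq show "c = d \<and> x = y" by simp
  qed
  have img: "?f ` (UNIV \<times> span B) = span (insert b B)"
  proof (intro equalityI subsetI)
    fix y assume "y \<in> span (insert b B)"
    then obtain c where "y - c *s b \<in> span B" by (auto simp: span_insert)
    then show "y \<in> ?f ` (UNIV \<times> span B)"
      by (intro image_eqI[of _ _ "(c, y - c *s b)"]) auto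
  qed (auto intro!: span_add span_scale intro: span_base span_mono[THEN subsetD, of B])
  have fin: "finite (span B)" "card (span B) = q ^ card B" using insert.IH ind by auto
  have "card (span (insert b B)) = card (UNIV \<times> span B :: ('a \<times> 'b) set)"
    unfolding img[symmetric] by (rule card_image[OF inj])
  moreover have "finite (span (insert b B))"
    unfolding img[symmetric] using fin by (intro finite_imageI finite_cartesian_product) auto
  ultimately show ?case using fin insert.hyps by (simp add: card_cartesian_product q_eq)
qed simp

end

text \<open>Serves to identify a subspace with the extension field, in both directions, by matching
  bases.\<close>

lemma (in vector_space_pair) linear_independent_extend_inj_on:
  assumes "finite B" "vs1.independent B" "vs2.independent (f ` B)" "inj_on f B"
  obtains g where "Vector_Spaces.linear s1 s2 g" "range g = vs2.span (f ` B)" "inj_on g (vs1.span B)"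
proof -
  obtain g where g: "Vector_Spaces.linear s1 s2 g" "\<forall>x\<in>B. g x = f x" "range g = vs2.span (f ` B)"
    using linear_independent_extend_subspace[OF assms(2)] by blast
  interpret g: Vector_Spaces.linear s1 s2 g by fact
  have "g ` B = f ` B" "inj_on g B" using g(2) assms(4) by (auto simp: inj_on_def)
  then have z: "x = 0" if "x \<in> vs1.span B" "g x = 0" for x
    using linear_indep_image_lemma[OF g(1) assms(1), of x] that assms(3) by simp
  have "inj_on g (vs1.span B)"
  proof (rule inj_onI)
    fix x y assume "x \<in> vs1.span B" "y \<in> vs1.span B" "g x = g y"
    then have "x - y = 0" by (intro z) (auto simp: vs1.span_diff g.diff)
    then show "x = y" by simp
  qed
  with g that show ?thesis by blast
qed

locale finite_field_space = finite_dimensional_vector_space scale Basis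
  for scale :: "'a::{field,finite} \<Rightarrow> 'b::ab_group_add \<Rightarrow> 'b" (infixr "*s" 75) and Basis +
  fixes q :: nat
  assumes card_scalars: "q = CARD('a)"
begin

sublocale finite_field_vector_space scale q
  by unfold_locales (rule card_scalars)

lemma finite_UNIV_space: "finite (UNIV :: 'b set)"
  using card_span_independent[OF finite_Basis independent_Basis] span_Basis by simp

lemma finite_subset_space [simp]: "finite (S :: 'b set)"
  by (rule finite_subset[OF subset_UNIV finite_UNIV_space])

lemma finite_space_sets [simp]: "finite (\<S> :: 'b set set)"
  by (rule finite_subset[OF subset_UNIV]) (simp add: Finite_Set.finite_set finite_UNIV_space)

lemma card_subspace: 
  assumes "subspace S"
  shows "card S = q ^ dim S"
proof -
  obtain B where "B \<subseteq> S" "independent B" "S \<subseteq> span B" "card B = dim S"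
    using basis_exists by blast
  moreover have "span B = S" using calculation assms by (metis span_subspace)
  ultimately show ?thesis
    using card_span_independent[of B] by simp
qed

text \<open>The product of the extension field of degree \<open>dim E\<close>, transported to \<open>E \<times> W/E\<close>.\<close>
lemma exists_nondegenerate_product:
  assumes E: "subspace E" and W: "subspace W" and EW: "E \<subseteq> W"
    and m: "dim E \<ge> 1" and dimW: "dim W \<le> 2 * dim E"
  obtains p :: "'b \<Rightarrow> 'b \<Rightarrow> 'b" where
    "\<And>e x. p e x \<in> E"
    "\<And>e d x. p (e - d) x = p e x - p d x"
    "\<And>e. Vector_Spaces.linear scale scale (p e)"
    "\<And>e x. x \<in> E \<Longrightarrow> p e x = 0"
    "\<And>e x. e \<in> E \<Longrightarrow> x \<in> W \<Longrightarrow> p e x = 0 \<Longrightarrow> e = 0 \<or> x \<in> E"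
proof -
  let ?n = "q ^ dim E"
  let ?s = "\<lambda>c (x :: 'a alg_closure). to_ac c * x"
  \<comment> \<open>The extension field with \<open>q ^ dim E\<close> elements, which has dimension
    \<open>dim E\<close> over the scalars.\<close>
  define K where "K = {x::'a alg_closure. x ^ ?n = x}"
  interpret ac: finite_field_vector_space ?s q
    by unfold_locales (auto simp: algebra_simps q_eq)
  interpret fw: vector_space_pair scale ?s by unfold_locales
  interpret bk: vector_space_pair ?s scale by unfold_locales
  have cardK: "card K = ?n"
    unfolding K_def q_eq using m by (intro card_alg_closure_power_fixpoints) simp
  have n0: "?n > 0" using q_gt_1 by simp
  have K_add: "x + y \<in> K" if "x \<in> K" "y \<in> K" for x y
    using that by (simp add: K_def q_eq alg_closure_add_power_card)
  have K_mult: "x * y \<in> K" if "x \<in> K" "y \<in> K" for x y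
    using that by (simp add: K_def power_mult_distrib)
  have to_ac_K: "to_ac c \<in> K" for c
  proof -
    have "c ^ (CARD('a) ^ j) = c" for j
      by (induction j) (simp_all add: power_mult finite_field_power_card)
    then show ?thesis by (simp add: K_def q_eq flip: to_ac_power)
  qed
  have subK: "ac.subspace K"
    using to_ac_K n0 by (intro ac.subspaceI K_add K_mult) (auto simp: K_def)
  have finK: "finite K" using cardK n0 by (metis card.infinite less_numeral_extra(3))
  obtain BK where BK: "BK \<subseteq> K" "ac.independent BK" "K \<subseteq> ac.span BK"
    using ac.maximal_independent_subset by metis
  then have spanBK: "ac.span BK = K" using subK by (metis ac.span_subspace)
  have finBK: "finite BK" using BK(1) finK finite_subset by blast
  have cardBK: "card BK = dim E"
  proof -
    have "q ^ card BK = q ^ dim E"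
      using ac.card_span_independent[OF finBK BK(2)] spanBK cardK by simp
    then show ?thesis using q_gt_1 by simp
  qed
  obtain BE where BE: "BE \<subseteq> E" "independent BE" "E \<subseteq> span BE" "card BE = dim E"
    using basis_exists by blast
  then have spanBE: "span BE = E" using E by (metis span_subspace)
  obtain BW where BW: "BE \<subseteq> BW" "BW \<subseteq> W" "independent BW" "W \<subseteq> span BW"
    using maximal_independent_subset_extend[of BE W] BE EW by (metis subset_trans)
  then have spanBW: "span BW = W" using W by (metis span_subspace)
  have cardBW: "card BW = dim W" using BW by (metis basis_card_eq_dim)
  obtain f where f: "bij_betw f BE BK"
    using finite_same_card_bij[of BE BK] finBK cardBK BE(4) by auto
  obtain th where th: "Vector_Spaces.linear scale ?s th" "range th = ac.span BK" "inj_on th (span BE)"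
    using fw.linear_independent_extend_inj_on[of BE f] f BE(2) BK(2)
    by (auto simp: bij_betw_def)
  obtain f' where f': "bij_betw f' BK BE"
    using finite_same_card_bij[of BK BE] finBK cardBK BE(4) by auto
  \<comment> \<open>\<open>ps\<close> need not invert \<open>th\<close>: any linear map that takes
    \<open>K\<close> bijectively onto \<open>E\<close> will do.\<close>
  obtain ps where ps: "Vector_Spaces.linear ?s scale ps" "range ps = span BE" "inj_on ps (ac.span BK)"
    using bk.linear_independent_extend_inj_on[of BK f'] f' BE(2) BK(2) finBK
    by (auto simp: bij_betw_def)
  have "card (BW - BE) \<le> card BK"
    using card_Diff_subset[of BE BW] BW(1) cardBW cardBK BE(4) dimW by simp
  then obtain g where g: "g ` (BW - BE) \<subseteq> BK" "inj_on g (BW - BE)"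
    using card_le_inj[of "BW - BE" BK] finBK by auto
  \<comment> \<open>The map \<open>ch\<close> built from \<open>g'\<close> kills \<open>E\<close>
    and sends the other basis vectors of \<open>W\<close> injectively into a basis of
    \<open>K\<close>, so its kernel within \<open>W\<close> is \<open>E\<close>. There is room for
    this since \<open>dim W - dim E \<le> dim E\<close>.\<close>
  define g' where "g' b = (if b \<in> BE then 0 else g b)" for b
  obtain ch where ch: "Vector_Spaces.linear scale ?s ch" "\<forall>x\<in>BW. ch x = g' x" "range ch = ac.span (g' ` BW)"
    using fw.linear_independent_extend_subspace[OF BW(3)] by blast
  interpret th: Vector_Spaces.linear scale ?s th by fact
  interpret ps: Vector_Spaces.linear ?s scale ps by fact
  interpret ch: Vector_Spaces.linear scale ?s ch by fact
  have ch_K: "ch x \<in> K" for x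
  proof -
    have "ac.span (g' ` BW) \<subseteq> K"
      by (rule ac.span_minimal[OF _ subK]) (use g BK(1) subK ac.subspace_0 in \<open>auto simp: g'_def\<close>)
    then show ?thesis using ch(3) by auto
  qed
  have th_K: "th x \<in> K" for x using th(2) spanBK by auto
  have ch_E: "ch x = 0" if "x \<in> E" for x
  proof (rule ch.eq_0_on_span)
    show "x \<in> span BE" using that spanBE by simp
    show "ch b = 0" if "b \<in> BE" for b using ch(2) that BW(1) by (auto simp: g'_def)
  qed
  have ch_0: "x \<in> E" if "x \<in> W" "ch x = 0" for x
  proof -
    have "x \<in> span (BE \<union> (BW - BE))" using that(1) spanBW BW(1) by (simp add: Un_absorb1)
    then obtain y z where yz: "x = y + z" "y \<in> span BE" "z \<in> span (BW - BE)"
      unfolding span_Un by blast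
    have "ch z = 0" using that(2) ch_E[of y] yz spanBE by (simp add: ch.add)
    moreover have "ch ` (BW - BE) = g ` (BW - BE)" "inj_on ch (BW - BE)"
      using ch(2) g(2) by (auto simp: g'_def inj_on_def)
    moreover have "ac.independent (g ` (BW - BE))" using g(1) BK(2) ac.independent_mono by blast
    ultimately have "z = 0"
      using fw.linear_indep_image_lemma[OF ch(1), of "BW - BE" z] yz(3) by simp
    with yz spanBE show ?thesis by simp
  qed
  show ?thesis
  proof (rule that[of "\<lambda>e x. ps (th e * ch x)"])
    show "ps (th e * ch x) \<in> E" for e x using ps(2) spanBE by auto
    show "ps (th (e - d) * ch x) = ps (th e * ch x) - ps (th d * ch x)" for e d x
      by (simp add: th.diff left_diff_distrib ps.diff)
    show "Vector_Spaces.linear scale scale (\<lambda>x. ps (th e * ch x))" for e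
    proof (unfold Vector_Spaces.linear_iff, intro conjI allI)
      show "vector_space scale" by unfold_locales
      show "vector_space scale" by unfold_locales
      show "ps (th e * ch (x + y)) = ps (th e * ch x) + ps (th e * ch y)" for x y
        by (simp add: ch.add distrib_left ps.add)
      show "ps (th e * ch (c *s x)) = c *s ps (th e * ch x)" for c x
        using ps.scale[of c "th e * ch x"] by (simp add: ch.scale mult_ac)
    qed
    show "ps (th e * ch x) = 0" if "x \<in> E" for e x using ch_E[OF that] by simp
    \<comment> \<open>\<open>ps\<close> is injective on \<open>K\<close> and a field has no zero
      divisors, so \<open>th e\<close> or \<open>ch x\<close> vanishes.\<close>
    show "e = 0 \<or> x \<in> E" if "e \<in> E" "x \<in> W" "ps (th e * ch x) = 0" for e x
    proof -
      have "th e * ch x \<in> ac.span BK" using K_mult th_K ch_K spanBK by simp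
      then have "th e * ch x = 0" using ps(3) that(3) ac.span_zero unfolding inj_on_def
        by (metis ps.zero)
      then consider "th e = 0" | "ch x = 0" by auto
      then show ?thesis
      proof cases
        case 1
        then have "e = 0" using th(3) that(1) spanBE unfolding inj_on_def by (metis span_zero th.zero)
        then show ?thesis ..
      next
        case 2
        then show ?thesis using ch_0 that(2) by blast
      qed
    qed
  qed
qed

end

section \<open>Counting subspaces\<close>

context finite_field_space begin

abbreviation sumset :: "'b set \<Rightarrow> 'b set \<Rightarrow> 'b set" where
  "sumset S T \<equiv> {x + y | x y. x \<in> S \<and> y \<in> T}"

section \<open>Sums and intersections of subspaces\<close>

lemma sumset_superset1: "subspace T \<Longrightarrow> S \<subseteq> sumset S T"
  using subspace_0[of T] by force

lemma sumset_superset2: "subspace S \<Longrightarrow> T \<subseteq> sumset S T"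
  using subspace_0[of S] by force

lemma sumset_subset: "subspace W \<Longrightarrow> S \<subseteq> W \<Longrightarrow> T \<subseteq> W \<Longrightarrow> sumset S T \<subseteq> W"
  using subspace_add by blast

lemma dim_eq_0_iff: "subspace S \<Longrightarrow> dim S = 0 \<longleftrightarrow> S = {0}"
  using subspace_0[of S] by auto

lemma dim_Int_ge:
  assumes "subspace S" "subspace T" "subspace W" "S \<subseteq> W" "T \<subseteq> W"
  shows "dim S + dim T \<le> dim W + dim (S \<inter> T)"
  using dim_sums_Int[OF assms(1,2)] dim_subset[OF sumset_subset[OF assms(3-5)]] by linarith

lemma Int_nontrivial:
  assumes "subspace S" "subspace T" "subspace W" "S \<subseteq> W" "T \<subseteq> W" "dim W < dim S + dim T"
  shows "S \<inter> T \<noteq> {0}"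
  using dim_Int_ge[OF assms(1-5)] assms(6) by auto

lemma Int_0_imp_sumset_eq:
  assumes "subspace S" "subspace T" "subspace W" "S \<subseteq> W" "T \<subseteq> W" "S \<inter> T = {0}"
    and "dim W \<le> dim S + dim T"
  shows "sumset S T = W"
  using dim_sums_Int[OF assms(1,2)] assms
  by (intro subspace_dim_equal subspace_sums sumset_subset) auto

lemma dim_pos: "subspace S \<Longrightarrow> S \<noteq> {0} \<Longrightarrow> dim S > 0"
  using dim_eq_0_iff by blast

text \<open>One family covers every count needed: \<open>S = {0}\<close> removes the condition from
  below, \<open>A = {0}\<close> the condition of avoidance.\<close>

definition subspaces_avoiding :: "'b set \<Rightarrow> 'b set \<Rightarrow> 'b set \<Rightarrow> nat \<Rightarrow> 'b set set" where
  "subspaces_avoiding W S A j = {D. subspace D \<and> dim D = j \<and> S \<subseteq> D \<and> D \<subseteq> W \<and> D \<inter> A = {0}}"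

lemma dim_span_insert: "subspace S \<Longrightarrow> v \<notin> S \<Longrightarrow> dim (span (insert v S)) = Suc (dim S)"
  by (simp add: dim_insert span_eq_iff[THEN iffD2])

lemma span_insert_avoids:
  assumes "subspace A" "subspace S" "A \<inter> S = {0}" "v \<notin> sumset A S"
  shows "A \<inter> span (insert v S) = {0}"
proof (intro equalityI subsetI)
  fix x assume x: "x \<in> A \<inter> span (insert v S)"
  then obtain c where c: "x - c *s v \<in> S" using assms(2) by (auto simp: span_insert span_eq_iff[THEN iffD2])
  have "c = 0"
  proof (rule ccontr)
    assume "c \<noteq> 0"
    define s where "s = x - c *s v"
    have "v = inverse c *s x + inverse c *s (- s)"
      using \<open>c \<noteq> 0\<close> by (simp add: s_def scale_right_diff_distrib)
    moreover have "inverse c *s x \<in> A" "inverse c *s (- s) \<in> S"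
      using x c unfolding s_def by (auto intro!: subspace_scale subspace_neg assms(1,2) simp del: scale_minus_right minus_diff_eq)
    ultimately show False using assms(4) by blast
  qed
  with c x assms(3) show "x \<in> {0}" by auto
qed (use assms(1) subspace_0 span_zero in auto)

text \<open>Double counting of pairs \<open>v \<in> D\<close> with \<open>v \<in> W\<close> outside
  \<open>A + S\<close>: such a \<open>v\<close> enlarges \<open>S\<close> without meeting
  \<open>A\<close>, and \<open>D\<close> contains \<open>q ^ j - q ^ dim S\<close> of them because
  \<open>D \<inter> (A + S) = S\<close>. Induction handles the enlarged \<open>S\<close>.\<close>

lemma card_subspaces_avoiding_prod:
  assumes "subspace W" "subspace S" "subspace A" "S \<subseteq> W" "A \<subseteq> W" "A \<inter> S = {0}" "dim S \<le> j"
  shows "real (card (subspaces_avoiding W S A j)) =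
    (\<Prod>t=dim S..<j. (real q ^ dim W - real q ^ (dim A + t)) / (real q ^ j - real q ^ t))"
  using assms
proof (induction "j - dim S" arbitrary: S)
  case 0
  then have "dim S = j" by simp
  moreover from this have "subspaces_avoiding W S A j = {S}"
    using 0 by (auto simp: subspaces_avoiding_def dest: subspace_dim_equal[of S])
  ultimately show ?case by simp
next
  case (Suc d S)
  let ?N = "\<lambda>S. subspaces_avoiding W S A j"
  let ?P = "\<lambda>s. \<Prod>t=s..<j. (real q ^ dim W - real q ^ (dim A + t)) / (real q ^ j - real q ^ t)"
  let ?T = "W - sumset A S"
  have lt: "dim S < j" using Suc.hyps(2) by simp
  have "(\<Sum>v\<in>?T. card {D\<in>?N S. v \<in> D}) = (\<Sum>D\<in>?N S. card {v\<in>?T. v \<in> D})"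
    by (rule double_count) auto
  moreover have "real (card {D\<in>?N S. v \<in> D}) = ?P (Suc (dim S))" if v: "v \<in> ?T" for v
  proof -
    have vS: "v \<notin> S" using v sumset_superset2[OF Suc.prems(3), of S] by auto
    have "{D\<in>?N S. v \<in> D} = ?N (span (insert v S))"
      using span_minimal[of "insert v S"] span_superset[of "insert v S"]
      by (auto simp: subspaces_avoiding_def)
    moreover have "span (insert v S) \<subseteq> W"
      using v Suc.prems by (intro span_minimal) auto
    moreover have "A \<inter> span (insert v S) = {0}" using Suc.prems v by (intro span_insert_avoids) auto
    ultimately show ?thesis
      using Suc.hyps(1)[of "span (insert v S)"] Suc.prems Suc.hyps(2) lt
        dim_span_insert[OF Suc.prems(2) vS] by simp
  qed
  moreover have "real (card {v\<in>?T. v \<in> D}) = real q ^ j - real q ^ dim S" if D: "D \<in> ?N S" for D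
  proof -
    have D': "subspace D" "dim D = j" "S \<subseteq> D" "D \<subseteq> W" "D \<inter> A = {0}"
      using D by (auto simp: subspaces_avoiding_def)
    have "{v\<in>?T. v \<in> D} = D - S"
    proof (intro equalityI subsetI)
      fix v assume v: "v \<in> D - S"
      have "v \<notin> sumset A S"
      proof
        assume "v \<in> sumset A S"
        then obtain a s where as: "v = a + s" "a \<in> A" "s \<in> S" by blast
        have "v - s \<in> D" using v as D' by (intro subspace_diff) auto
        then have "a \<in> D" using as by simp
        then have "a = 0" using as D' by auto
        with as v show False by simp
      qed
      with v D' show "v \<in> {v\<in>?T. v \<in> D}" by auto
    qed (use sumset_superset2[OF Suc.prems(3), of S] in auto)
    moreover have "card (D - S) = card D - card S" using D' by (intro card_Diff_subset) auto
    moreover have "card S \<le> card D" using D' by (intro card_mono) auto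
    ultimately show ?thesis using card_subspace D'(1,2) Suc.prems(2) by (simp add: of_nat_diff)
  qed
  ultimately have eq: "real (card ?T) * ?P (Suc (dim S)) = real (card (?N S)) * (real q ^ j - real q ^ dim S)"
    using sum.cong[of ?T ?T "\<lambda>v. real (card {D\<in>?N S. v \<in> D})" "\<lambda>v. ?P (Suc (dim S))"]
      sum.cong[of "?N S" "?N S" "\<lambda>D. real (card {v\<in>?T. v \<in> D})" "\<lambda>D. real q ^ j - real q ^ dim S"]
    by (simp only: sum_constant flip: of_nat_sum)
  have "card (sumset A S) = q ^ (dim A + dim S)"
    using card_subspace[OF subspace_sums[OF Suc.prems(3,2)]] dim_sums_Int[OF Suc.prems(3,2)] Suc.prems(6) by simp
  moreover have sub: "sumset A S \<subseteq> W" using Suc.prems by (intro sumset_subset) auto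
  moreover have "card (sumset A S) \<le> card W" using sub by (intro card_mono) auto
  ultimately have T: "real (card ?T) = real q ^ dim W - real q ^ (dim A + dim S)"
    using card_subspace[OF Suc.prems(1)] by (simp add: card_Diff_subset of_nat_diff)
  have "real q ^ j - real q ^ dim S > 0" using lt q_gt_1 by (simp add: power_strict_increasing)
  with eq T have "real (card (?N S)) =
      (real q ^ dim W - real q ^ (dim A + dim S)) / (real q ^ j - real q ^ dim S) * ?P (Suc (dim S))"
    by (simp add: field_simps)
  with lt show ?case by (simp add: prod.atLeast_Suc_lessThan)
qed

lemma card_subspaces_avoiding:
  assumes "subspace W" "subspace S" "subspace A" "S \<subseteq> W" "A \<subseteq> W" "A \<inter> S = {0}" "dim S \<le> j"
    and "dim A + j \<le> dim W"
  shows "real (card (subspaces_avoiding W S A j)) =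
    real q ^ (dim A * (j - dim S)) * gauss_binomial q (dim W - dim A - dim S) (j - dim S)"
proof -
  let ?s = "dim S" and ?a = "dim A" and ?w = "dim W"
  have "(\<Prod>t=?s..<j. (real q ^ ?w - real q ^ (?a + t)) / (real q ^ j - real q ^ t)) =
      (\<Prod>u<j-?s. (real q ^ ?w - real q ^ (?a + (?s + u))) / (real q ^ j - real q ^ (?s + u)))"
    using assms(7) by (intro prod.reindex_bij_witness[of _ "\<lambda>u. ?s + u" "\<lambda>t. t - ?s"]) auto
  \<comment> \<open>Numerator and denominator share the factor \<open>q ^ (dim S + u)\<close>; after
    cancelling it, \<open>q ^ dim A\<close> remains in front.\<close>
  also have "\<dots> = (\<Prod>u<j-?s. real q ^ ?a * ((real q ^ (?w - ?a - ?s - u) - 1) / (real q ^ (j - ?s - u) - 1)))"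
  proof (rule prod.cong[OF refl])
    fix u assume u: "u \<in> {..<j - ?s}"
    have "real q ^ ?w = real q ^ ?a * (real q ^ (?s + u) * real q ^ (?w - ?a - ?s - u))"
      using assms u by (simp flip: power_add)
    then have num: "real q ^ ?w - real q ^ (?a + (?s + u)) =
        real q ^ (?s + u) * (real q ^ ?a * (real q ^ (?w - ?a - ?s - u) - 1))"
      by (simp add: power_add algebra_simps)
    have "real q ^ j = real q ^ (?s + u) * real q ^ (j - ?s - u)"
      using assms u by (simp flip: power_add)
    then have den: "real q ^ j - real q ^ (?s + u) = real q ^ (?s + u) * (real q ^ (j - ?s - u) - 1)"
      by (simp add: algebra_simps)
    have "real q ^ (?s + u) \<noteq> 0" using q_gt_1 by simp
    then show "(real q ^ ?w - real q ^ (?a + (?s + u))) / (real q ^ j - real q ^ (?s + u)) =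
        real q ^ ?a * ((real q ^ (?w - ?a - ?s - u) - 1) / (real q ^ (j - ?s - u) - 1))"
      unfolding num den using q_gt_1 by simp
  qed
  also have "\<dots> = real q ^ (?a * (j - ?s)) * gauss_binomial q (?w - ?a - ?s) (j - ?s)"
    by (simp add: gauss_binomial_def prod.distrib power_mult prod_dividef)
  finally show ?thesis using card_subspaces_avoiding_prod[OF assms(1-7)] by simp
qed

definition grassmannian :: "'b set \<Rightarrow> nat \<Rightarrow> 'b set set" where
  "grassmannian W j = {D. subspace D \<and> dim D = j \<and> D \<subseteq> W}"

lemma card_subspaces_between:
  assumes "subspace W" "subspace S" "S \<subseteq> W" "dim S \<le> j" "j \<le> dim W"
  shows "real (card {D\<in>grassmannian W j. S \<subseteq> D}) = gauss_binomial q (dim W - dim S) (j - dim S)"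
proof -
  have "{D\<in>grassmannian W j. S \<subseteq> D} = subspaces_avoiding W S {0} j"
    using subspace_0 by (auto simp: grassmannian_def subspaces_avoiding_def)
  moreover have "{0} \<inter> S = {0}" "dim {0::'b} = 0" using assms(2) subspace_0 by auto
  ultimately show ?thesis using card_subspaces_avoiding[of W S "{0}" j] assms subspace_0
    by (simp add: subspace_single_0)
qed

lemma card_grassmannian:
  assumes "subspace W" "j \<le> dim W"
  shows "real (card (grassmannian W j)) = gauss_binomial q (dim W) j"
proof -
  have "{D\<in>grassmannian W j. {0} \<subseteq> D} = grassmannian W j"
    using subspace_0 by (auto simp: grassmannian_def)
  then show ?thesis
    using card_subspaces_between[of W "{0}" j] assms subspace_0 by (simp add: subspace_single_0)
qed

text \<open>For \<open>j = dim W - dim A\<close> the Gaussian factor in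
  \<open>card_subspaces_avoiding\<close> is \<open>1\<close>.\<close>

lemma card_complements:
  assumes "subspace W" "subspace A" "A \<subseteq> W"
  shows "card {D\<in>grassmannian W (dim W - dim A). D \<inter> A = {0}} = q ^ (dim A * (dim W - dim A))"
proof -
  have "{D\<in>grassmannian W (dim W - dim A). D \<inter> A = {0}} = subspaces_avoiding W {0} A (dim W - dim A)"
    using subspace_0 by (auto simp: grassmannian_def subspaces_avoiding_def)
  moreover have "dim A \<le> dim W" "A \<inter> {0} = {0}" using assms dim_subset subspace_0 by auto
  ultimately have "real (card {D\<in>grassmannian W (dim W - dim A). D \<inter> A = {0}}) = real (q ^ (dim A * (dim W - dim A)))"
    using card_subspaces_avoiding[of W "{0}" A "dim W - dim A"] assms subspace_0 q_gt_1
    by (simp add: subspace_single_0 gauss_binomial_self)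
  then show ?thesis by linarith
qed

end

section \<open>Cross-intersecting families\<close>

context finite_field_space begin

text \<open>The images of \<open>h\<close> under the shears \<open>x + p e x\<close> with
  \<open>e \<in> E\<close> are \<open>q ^ dim E\<close> complements of \<open>E\<close>, and members
  that meet nontrivially never share an image. Hence \<open>H \<times> E\<close> injects into the
  set of all complements of \<open>E\<close>.\<close>

lemma card_intersecting_complements:
  assumes W: "subspace W" and E: "subspace E" "E \<subseteq> W" and i: "1 \<le> i" "2 * i \<le> dim W" "dim E = dim W - i"
    and H: "H \<subseteq> grassmannian W i" "\<And>h. h \<in> H \<Longrightarrow> h \<inter> E = {0}"
    and int: "\<And>h h'. h \<in> H \<Longrightarrow> h' \<in> H \<Longrightarrow> h \<inter> h' \<noteq> {0}"
  shows "card H * q ^ dim E \<le> q ^ (dim E * i)"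
proof -
  have dE: "dim E \<ge> 1" "dim W \<le> 2 * dim E" "dim W - dim E = i" using i by auto
  from exists_nondegenerate_product[OF E(1) W E(2) dE(1,2)]
  obtain p :: "'b \<Rightarrow> 'b \<Rightarrow> 'b" where p: "\<And>e x. p e x \<in> E"
    "\<And>e d x. p (e - d) x = p e x - p d x" "\<And>e. Vector_Spaces.linear scale scale (p e)"
    "\<And>e x. x \<in> E \<Longrightarrow> p e x = 0"
    "\<And>e x. e \<in> E \<Longrightarrow> x \<in> W \<Longrightarrow> p e x = 0 \<Longrightarrow> e = 0 \<or> x \<in> E" by blast
  \<comment> \<open>\<open>T e\<close> is linear and injective, fixes \<open>E\<close> pointwise and
    moves vectors only along \<open>E\<close>, so it carries complements of \<open>E\<close> in
    \<open>W\<close> to complements.\<close>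
  define T where "T e x = x + p e x" for e x
  have T_add: "T e (x + y) = T e x + T e y" and T_scale: "T e (c *s x) = c *s T e x" for e x y c
    using p(3) by (simp_all add: T_def Vector_Spaces.linear_iff scale_right_distrib)
  have T_eq: "x = y" if "T e x = T e y" for e x y
  proof -
    have "p e (x - y) = p e x - p e y" 
      by (rule module_hom.diff) (use p(3) in \<open>simp add: linear_iff_module_hom\<close>)
    moreover have "x - y = p e y - p e x" using that by (simp add: T_def algebra_simps)
    ultimately have "x - y = - p e (x - y)" by simp
    moreover from this have "x - y \<in> E" using p(1) E(1) by (metis subspace_neg)
    ultimately show ?thesis using p(4)[of "x - y" e] by simp
  qed
  let ?C = "{D\<in>grassmannian W (dim W - dim E). D \<inter> E = {0}}"
  let ?f = "\<lambda>(h, e). T e ` h"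
  have "?f ` (H \<times> E) \<subseteq> ?C"
  proof clarify
    fix h e assume h: "h \<in> H" and e: "e \<in> E"
    have h': "subspace h" "dim h = i" "h \<subseteq> W" using h H by (auto simp: grassmannian_def)
    have sub: "subspace (T e ` h)"
      using h' by (auto intro!: subspaceI simp flip: T_add T_scale simp: subspace_add subspace_scale)
         (use h'(1) p(4)[OF subspace_0[OF E(1)]] subspace_0 in \<open>force simp: T_def image_iff\<close>)
    have "card (T e ` h) = card h" by (rule card_image) (auto intro!: inj_onI dest: T_eq)
    then have "dim (T e ` h) = dim h"
      using card_subspace[OF sub] card_subspace[OF h'(1)] q_gt_1 by simp
    moreover have "T e ` h \<subseteq> W"
      using h'(3) p(1) E(2) W by (auto simp: T_def intro!: subspace_add)
    moreover have "T e ` h \<inter> E = {0}"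
    proof (intro equalityI subsetI)
      fix y assume "y \<in> T e ` h \<inter> E"
      then obtain x where x: "x \<in> h" "y = x + p e x" "y \<in> E" by (auto simp: T_def)
      then have "y - p e x \<in> E" using p(1) E(1) by (intro subspace_diff) auto
      then have "x = 0" using x H(2)[OF h] by auto
      then show "y \<in> {0}" using x p(4)[OF subspace_0[OF E(1)]] by simp
    qed (use sub E(1) subspace_0 in auto)
    ultimately show "T e ` h \<in> grassmannian W (dim W - dim E) \<and> T e ` h \<inter> E = {0}"
      using sub h' dE by (simp add: grassmannian_def)
  qed
  moreover have "inj_on ?f (H \<times> E)"
  proof (rule inj_onI, clarify)
    fix h e h' e'
    assume h: "h \<in> H" "h' \<in> H" and e: "e \<in> E" "e' \<in> E" and eq: "T e ` h = T e' ` h'"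
    have sub: "subspace h" "subspace h'" using h H by (auto simp: grassmannian_def)
    \<comment> \<open>A common nonzero vector determines the shear: \<open>T e z = T e' y\<close>
      with \<open>y \<in> h'\<close> puts \<open>z - y\<close> into \<open>E \<inter> h'\<close>, so
      \<open>y = z\<close> and \<open>p (e - e') z = 0\<close> with
      \<open>z \<notin> E\<close>.\<close>
    obtain z where z: "z \<in> h" "z \<in> h'" "z \<noteq> 0"
      using int[OF h] sub subspace_0 by blast
    obtain y where y: "y \<in> h'" "T e z = T e' y" using z eq by (metis (no_types, lifting) image_iff)
    have "z - y = p e' y - p e z" using y(2) by (simp add: T_def algebra_simps)
    then have "z - y \<in> E" using p(1) E(1) by (simp add: subspace_diff)
    moreover have "z - y \<in> h'" using sub y z by (simp add: subspace_diff)
    ultimately have "z - y = 0" using H(2)[OF h(2)] by blast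
    then have "z = y" by simp
    with y(2) have "p (e - e') z = 0" by (simp add: T_def p(2))
    moreover have "z \<notin> E" using z H(2)[OF h(1)] by auto
    moreover have "z \<in> W" using z h H by (auto simp: grassmannian_def)
    moreover have "e - e' \<in> E" using e E(1) by (simp add: subspace_diff)
    ultimately have ee: "e = e'" using p(5)[of "e - e'" z] by auto
    have "h = h'" using eq T_eq unfolding ee by blast
    with ee show "h = h' \<and> e = e'" by simp
  qed
  ultimately have "card (H \<times> E) \<le> card ?C" by (intro card_inj_on_le) auto
  also have "card ?C = q ^ (dim E * i)" using card_complements[OF W E] dE by simp
  finally show ?thesis by (simp add: card_cartesian_product card_subspace[OF E(1)])
qed

text \<open>All complements of a member of \<open>H\<close> lie outside \<open>G\<close>. Counting
  pairs of \<open>h \<in> H\<close> and a complement \<open>E\<close> of it, each \<open>h\<close>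
  has \<open>q ^ (i * (dim W - i))\<close> of them, while
  \<open>card_intersecting_complements\<close> limits the \<open>h\<close> for each \<open>E\<close>
  to a fraction \<open>1 / q ^ (dim W - i)\<close> of that number.\<close>

lemma cross_intersecting_bound:
  assumes W: "subspace W" and i: "1 \<le> i" "2 * i \<le> dim W"
    and H: "H \<subseteq> grassmannian W i" and G: "G \<subseteq> grassmannian W (dim W - i)"
    and int: "\<And>h h'. h \<in> H \<Longrightarrow> h' \<in> H \<Longrightarrow> h \<inter> h' \<noteq> {0}"
    and cross: "\<And>h g. h \<in> H \<Longrightarrow> g \<in> G \<Longrightarrow> h \<inter> g \<noteq> {0}"
  shows "real (card G) + real q ^ (dim W - i) * real (card H) \<le> gauss_binomial q (dim W) i"
proof -
  let ?k = "dim W"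
  let ?E = "grassmannian W (?k - i) - G"
  have "(\<Sum>h\<in>H. card {E\<in>?E. h \<inter> E = {0}}) = (\<Sum>E\<in>?E. card {h\<in>H. h \<inter> E = {0}})"
    by (rule double_count) auto
  moreover have "card {E\<in>?E. h \<inter> E = {0}} = q ^ (i * (?k - i))" if h: "h \<in> H" for h
  proof -
    have "{E\<in>?E. h \<inter> E = {0}} = {E\<in>grassmannian W (?k - i). E \<inter> h = {0}}"
      using cross[OF h] by (auto simp: Int_commute)
    moreover have "subspace h" "dim h = i" "h \<subseteq> W" using h H by (auto simp: grassmannian_def)
    ultimately show ?thesis using card_complements[OF W, of h] by simp
  qed
  ultimately have "card H * q ^ (i * (?k - i)) = (\<Sum>E\<in>?E. card {h\<in>H. h \<inter> E = {0}})" by simp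
  then have "card H * q ^ (i * (?k - i)) * q ^ (?k - i) = (\<Sum>E\<in>?E. card {h\<in>H. h \<inter> E = {0}} * q ^ (?k - i))"
    by (simp add: sum_distrib_right)
  also have "\<dots> \<le> (\<Sum>E\<in>?E. q ^ (i * (?k - i)))"
  proof (rule sum_mono)
    fix E assume "E \<in> ?E"
    then have E: "subspace E" "E \<subseteq> W" "dim E = ?k - i" by (auto simp: grassmannian_def)
    show "card {h\<in>H. h \<inter> E = {0}} * q ^ (?k - i) \<le> q ^ (i * (?k - i))"
    proof -
      have "card {h\<in>H. h \<inter> E = {0}} * q ^ dim E \<le> q ^ (dim E * i)"
        by (rule card_intersecting_complements[OF W E(1,2) i E(3)]) (use H int in blast)+
      then show ?thesis by (simp only: E(3) mult.commute[of i])
    qed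
  qed
  also have "\<dots> = card ?E * q ^ (i * (?k - i))" by simp
  finally have "(card H * q ^ (?k - i)) * q ^ (i * (?k - i)) \<le> card ?E * q ^ (i * (?k - i))"
    by (simp only: mult.assoc mult.commute[of "q ^ (?k - i)"])
  then have "card H * q ^ (?k - i) \<le> card ?E" using q_gt_1 by simp
  then have "real (card H) * real q ^ (?k - i) \<le> real (card ?E)"
    by (metis of_nat_le_iff of_nat_mult of_nat_power)
  moreover have "real (card ?E) = gauss_binomial q ?k i - card G"
  proof -
    have "card ?E = card (grassmannian W (?k - i)) - card G" "card G \<le> card (grassmannian W (?k - i))"
      using G by (auto intro: card_Diff_subset card_mono)
    moreover have "gauss_binomial q ?k (?k - i) = gauss_binomial q ?k i"
      using gauss_binomial_symmetric[OF q_gt_1, of i ?k] i by simp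
    ultimately show ?thesis using card_grassmannian[OF W, of "?k - i"] by (simp add: of_nat_diff)
  qed
  ultimately show ?thesis by (simp add: mult.commute)
qed

end

section \<open>Upper shadows and the Erdos-Ko-Rado theorem\<close>

lemma sum_square_relation:
  fixes f :: "'c \<Rightarrow> real"
  assumes "finite A" "finite B"
  shows "(\<Sum>b\<in>B. (\<Sum>a | a \<in> A \<and> R a b. f a)\<^sup>2) =
    (\<Sum>a\<in>A. \<Sum>a'\<in>A. f a * f a' * real (card {b\<in>B. R a b \<and> R a' b}))"
proof -
  have "(\<Sum>b\<in>B. (\<Sum>a | a \<in> A \<and> R a b. f a)\<^sup>2) =
      (\<Sum>b\<in>B. \<Sum>a\<in>A. \<Sum>a'\<in>A. if R a b \<and> R a' b then f a * f a' else 0)"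
  proof (rule sum.cong[OF refl])
    fix b
    have "(\<Sum>a | a \<in> A \<and> R a b. f a) = (\<Sum>a\<in>A. if R a b then f a else 0)"
      using assms by (simp add: sum.inter_filter)
    then show "(\<Sum>a | a \<in> A \<and> R a b. f a)\<^sup>2 = (\<Sum>a\<in>A. \<Sum>a'\<in>A. if R a b \<and> R a' b then f a * f a' else 0)"
      by (simp only: power2_eq_square sum_product) (auto intro!: sum.cong)
  qed
  also have "\<dots> = (\<Sum>a\<in>A. \<Sum>a'\<in>A. \<Sum>b\<in>B. if R a b \<and> R a' b then f a * f a' else 0)"
    by (subst sum.swap, rule sum.cong[OF refl], subst sum.swap, simp)
  also have "\<dots> = (\<Sum>a\<in>A. \<Sum>a'\<in>A. f a * f a' * real (card {b\<in>B. R a b \<and> R a' b}))"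
    using assms by (intro sum.cong refl) (simp add: mult.commute flip: sum.inter_filter)
  finally show ?thesis .
qed

text \<open>Expand the squares of \<open>\<mu> * f a - g a\<close>. With \<open>g\<close> the image
  of \<open>f\<close> under an operator times its adjoint, this passes a norm bound from the
  operator to the adjoint.\<close>

lemma sum_mult_square_le:
  fixes f g :: "'c \<Rightarrow> real"
  assumes "\<mu> \<ge> 0" "(\<Sum>a\<in>A. (g a)\<^sup>2) \<le> \<mu> * (\<Sum>a\<in>A. f a * g a)" "finite A"
  shows "(\<Sum>a\<in>A. f a * g a) \<le> \<mu> * (\<Sum>a\<in>A. (f a)\<^sup>2)"
proof (cases "\<mu> = 0")
  case True
  then have "(\<Sum>a\<in>A. (g a)\<^sup>2) = 0"
    using assms sum_nonneg[of A "\<lambda>a. (g a)\<^sup>2"] by simp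
  then have "\<forall>a\<in>A. g a = 0" using assms(3) by (simp add: sum_nonneg_eq_0_iff)
  then show ?thesis using True by simp
next
  case False
  then have mu: "\<mu> > 0" using assms(1) by simp
  have "0 \<le> (\<Sum>a\<in>A. (\<mu> * f a - g a)\<^sup>2)" by (simp add: sum_nonneg)
  also have "\<dots> = \<mu>\<^sup>2 * (\<Sum>a\<in>A. (f a)\<^sup>2) - 2 * \<mu> * (\<Sum>a\<in>A. f a * g a) + (\<Sum>a\<in>A. (g a)\<^sup>2)"
    by (simp add: power2_diff power_mult_distrib sum.distrib sum_subtractf sum_distrib_left mult_ac)
  also have "\<dots> \<le> \<mu> * (\<mu> * (\<Sum>a\<in>A. (f a)\<^sup>2) - (\<Sum>a\<in>A. f a * g a))"
    using assms(2) by (simp add: algebra_simps power2_eq_square)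
  finally show ?thesis using mu by (simp add: zero_le_mult_iff)
qed

lemma square_sum_le_card_mult_sum_square:
  fixes f :: "'c \<Rightarrow> real"
  assumes "finite A"
  shows "(\<Sum>a\<in>A. f a)\<^sup>2 \<le> real (card A) * (\<Sum>a\<in>A. (f a)\<^sup>2)"
proof -
  let ?S = "\<Sum>a\<in>A. f a" and ?n = "real (card A)"
  have "0 \<le> (\<Sum>a\<in>A. (?n * f a - ?S)\<^sup>2)" by (simp add: sum_nonneg)
  also have "\<dots> = ?n\<^sup>2 * (\<Sum>a\<in>A. (f a)\<^sup>2) - 2 * ?n * ?S * ?S + ?n * ?S\<^sup>2"
    by (simp add: power2_diff power_mult_distrib sum.distrib sum_subtractf sum_distrib_left sum_distrib_right mult_ac)
  also have "\<dots> = ?n * (?n * (\<Sum>a\<in>A. (f a)\<^sup>2) - ?S\<^sup>2)"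
    by (simp add: algebra_simps power2_eq_square)
  finally show ?thesis using assms by (cases "A = {}") (auto simp: zero_le_mult_iff)
qed

section \<open>Inclusion operators between consecutive Grassmannians\<close>

context finite_field_space begin

text \<open>The q-integer \<open>(q ^ m - 1) / (q - 1)\<close>, which is the number of lines in
  dimension \<open>m\<close>.\<close>

abbreviation qnum :: "nat \<Rightarrow> real" where "qnum m \<equiv> gauss_binomial q m 1"

lemma qnum_Suc: "qnum (Suc m) = real q * qnum m + 1"
  using q_gt_1 by (simp add: gauss_binomial_1[unfolded One_nat_def] field_simps)

lemma qnum_0: "qnum 0 = 0"
  by (simp add: gauss_binomial_def)

lemma qnum_nonneg: "qnum m \<ge> 0"
  using q_gt_1 by (intro gauss_binomial_nonneg) simp

lemma card_covers:
  assumes "subspace W" "h \<in> grassmannian W j" "j < dim W"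
  shows "real (card {L\<in>grassmannian W (Suc j). h \<subseteq> L}) = qnum (dim W - j)"
  using card_subspaces_between[of W h "Suc j"] assms by (auto simp: grassmannian_def)

lemma card_cocovers:
  assumes "L \<in> grassmannian W (Suc j)"
  shows "real (card {h\<in>grassmannian W j. h \<subseteq> L}) = qnum (Suc j)"
proof -
  have "{h\<in>grassmannian W j. h \<subseteq> L} = grassmannian L j"
    using assms by (auto simp: grassmannian_def)
  then show ?thesis
    using card_grassmannian[of L j] gauss_binomial_symmetric[OF q_gt_1, of 1 "Suc j"] assms
    by (auto simp: grassmannian_def)
qed

text \<open>The only candidate above is \<open>h + h'\<close>, the only one below is
  \<open>h \<inter> h'\<close>, and by the dimension formula they have the right dimensions
  simultaneously. Thus both numbers are \<open>1\<close> or both are \<open>0\<close>.\<close>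

lemma card_common_covers:
  assumes W: "subspace W" and h: "h \<in> grassmannian W (Suc j)" "h' \<in> grassmannian W (Suc j)" "h \<noteq> h'"
  shows "card {L\<in>grassmannian W (Suc (Suc j)). h \<subseteq> L \<and> h' \<subseteq> L} = card {T\<in>grassmannian W j. T \<subseteq> h \<and> T \<subseteq> h'}"
proof -
  have sub: "subspace h" "subspace h'" "dim h = Suc j" "dim h' = Suc j" "h \<subseteq> W" "h' \<subseteq> W"
    using h by (auto simp: grassmannian_def)
  let ?S = "sumset h h'"
  have S: "subspace ?S" "h \<subseteq> ?S" "h' \<subseteq> ?S" "?S \<subseteq> W"
    using sub by (intro subspace_sums sumset_superset1 sumset_superset2 sumset_subset W; simp)+
  have Int: "subspace (h \<inter> h')" using sub by (intro subspace_inter)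
  have dims: "dim ?S + dim (h \<inter> h') = 2 * Suc j" using dim_sums_Int[of h h'] sub by simp
  have lt: "dim (h \<inter> h') \<le> j"
  proof (rule ccontr)
    assume "\<not> dim (h \<inter> h') \<le> j"
    then have "h \<inter> h' = h" "h \<inter> h' = h'"
      using sub by (intro subspace_dim_equal[OF Int]; simp)+
    with h(3) show False by simp
  qed
  have up: "?S \<subseteq> L" if "L \<in> grassmannian W (Suc (Suc j))" "h \<subseteq> L" "h' \<subseteq> L" for L
    using that by (intro sumset_subset) (auto simp: grassmannian_def)
  show ?thesis
  proof (cases "dim (h \<inter> h') = j")
    case True
    have "{L\<in>grassmannian W (Suc (Suc j)). h \<subseteq> L \<and> h' \<subseteq> L} = {?S}"
    proof (intro equalityI subsetI)
      fix L assume L: "L \<in> {L\<in>grassmannian W (Suc (Suc j)). h \<subseteq> L \<and> h' \<subseteq> L}"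
      then have "?S = L" using up[of L] S(1) dims True by (intro subspace_dim_equal) (auto simp: grassmannian_def)
      then show "L \<in> {?S}" by simp
    qed (use S dims True in \<open>simp add: grassmannian_def\<close>)
    moreover have "{T\<in>grassmannian W j. T \<subseteq> h \<and> T \<subseteq> h'} = {h \<inter> h'}"
    proof (intro equalityI subsetI)
      fix T assume T: "T \<in> {T\<in>grassmannian W j. T \<subseteq> h \<and> T \<subseteq> h'}"
      then have "T = h \<inter> h'" using Int True by (intro subspace_dim_equal) (auto simp: grassmannian_def)
      then show "T \<in> {h \<inter> h'}" by simp
    qed (use Int True sub in \<open>auto simp: grassmannian_def\<close>)
    ultimately show ?thesis by simp
  next
    case False
    have "\<not> (h \<subseteq> L \<and> h' \<subseteq> L)" if "L \<in> grassmannian W (Suc (Suc j))" for L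
      using up[OF that] dim_subset[of ?S L] dims lt False that by (auto simp: grassmannian_def)
    moreover have "\<not> (T \<subseteq> h \<and> T \<subseteq> h')" if "T \<in> grassmannian W j" for T
      using dim_subset[of T "h \<inter> h'"] lt False that by (auto simp: grassmannian_def)
    ultimately have "{L\<in>grassmannian W (Suc (Suc j)). h \<subseteq> L \<and> h' \<subseteq> L} = {}"
      "{T\<in>grassmannian W j. T \<subseteq> h \<and> T \<subseteq> h'} = {}" by blast+
    then show ?thesis by (simp only: card.empty)
  qed
qed

text \<open>The commutation relation of the up and down operators: by
  \<open>card_common_covers\<close> the off-diagonal coefficients agree, so only the difference of
  the two degrees remains on the diagonal.\<close>

lemma sum_square_up_down:
  assumes W: "subspace W" and j: "Suc j < dim W"
  shows "(\<Sum>L\<in>grassmannian W (Suc (Suc j)). (\<Sum>h | h \<in> grassmannian W (Suc j) \<and> h \<subseteq> L. f h)\<^sup>2) =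
    (\<Sum>T\<in>grassmannian W j. (\<Sum>h | h \<in> grassmannian W (Suc j) \<and> T \<subseteq> h. f h)\<^sup>2) +
    (qnum (dim W - Suc j) - qnum (Suc j)) * (\<Sum>h\<in>grassmannian W (Suc j). (f h)\<^sup>2)"
proof -
  let ?G = "grassmannian W (Suc j)"
  let ?u = "\<lambda>h h'. real (card {L\<in>grassmannian W (Suc (Suc j)). h \<subseteq> L \<and> h' \<subseteq> L})"
  let ?d = "\<lambda>h h'. real (card {T\<in>grassmannian W j. T \<subseteq> h \<and> T \<subseteq> h'})"
  have "(\<Sum>h\<in>?G. \<Sum>h'\<in>?G. f h * f h' * ?u h h') =
      (\<Sum>h\<in>?G. \<Sum>h'\<in>?G. f h * f h' * ?d h h' +
        (if h' = h then (qnum (dim W - Suc j) - qnum (Suc j)) * (f h)\<^sup>2 else 0))"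
  proof (intro sum.cong refl)
    fix h h' assume h: "h \<in> ?G" "h' \<in> ?G"
    show "f h * f h' * ?u h h' = f h * f h' * ?d h h' +
        (if h' = h then (qnum (dim W - Suc j) - qnum (Suc j)) * (f h)\<^sup>2 else 0)"
    proof (cases "h' = h")
      case True
      then show ?thesis
        using card_covers[OF W h(1) j] card_cocovers[OF h(1)] by (simp add: algebra_simps power2_eq_square)
    qed (use card_common_covers[OF W h] in auto)
  qed
  also have "\<dots> = (\<Sum>h\<in>?G. \<Sum>h'\<in>?G. f h * f h' * ?d h h') +
      (qnum (dim W - Suc j) - qnum (Suc j)) * (\<Sum>h\<in>?G. (f h)\<^sup>2)"
    by (simp add: sum.distrib sum_distrib_left)
  finally show ?thesis
    using sum_square_relation[where A = ?G and B = "grassmannian W (Suc (Suc j))" and R = "\<lambda>h L. h \<subseteq> L" and f = f]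
      sum_square_relation[where A = ?G and B = "grassmannian W j" and R = "\<lambda>h T. T \<subseteq> h" and f = f] by simp
qed

text \<open>Sum zero excludes the constant functions, which carry the top eigenvalue. By
  \<open>sum_square_up_down\<close> the norm of the up operator is governed by that of the down
  operator, which is the adjoint of the up operator one dimension lower and obeys the same bound by
  induction.\<close>

lemma up_operator_bound:
  assumes W: "subspace W"
  shows "j < dim W \<Longrightarrow> (\<Sum>h\<in>grassmannian W j. f h) = 0 \<Longrightarrow>
    (\<Sum>L\<in>grassmannian W (Suc j). (\<Sum>h | h \<in> grassmannian W j \<and> h \<subseteq> L. f h)\<^sup>2) \<le>
      real q * qnum j * qnum (dim W - Suc j) * (\<Sum>h\<in>grassmannian W j. (f h)\<^sup>2)"
proof (induction j arbitrary: f)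
  case 0
  have g0: "grassmannian W 0 = {{0}}"
    using W subspace_0[OF W] by (auto simp: grassmannian_def subspace_single_0 dim_eq_0_iff dest: subspace_0)
  have "{h. h = {0} \<and> h \<subseteq> L} = {{0}}" if "L \<in> grassmannian W (Suc 0)" for L
    using that subspace_0 by (auto simp: grassmannian_def)
  with 0 show ?case by (simp add: g0 qnum_0)
next
  case (Suc j)
  let ?G = "grassmannian W (Suc j)"
  define g where "g T = (\<Sum>h | h \<in> ?G \<and> T \<subseteq> h. f h)" for T
  define u where "u h = (\<Sum>T | T \<in> grassmannian W j \<and> T \<subseteq> h. g T)" for h
  define \<mu> where "\<mu> = real q * qnum j * qnum (dim W - Suc j)"
  have mu: "\<mu> \<ge> 0" unfolding \<mu>_def using qnum_nonneg by simp
  have "(\<Sum>T\<in>grassmannian W j. g T) = (\<Sum>h\<in>?G. \<Sum>T | T \<in> grassmannian W j \<and> T \<subseteq> h. f h)"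
    unfolding g_def by (rule sum.swap_restrict) auto
  also have "\<dots> = (\<Sum>h\<in>?G. qnum (Suc j) * f h)"
    using card_cocovers by (intro sum.cong refl) simp
  also have "\<dots> = 0" using Suc.prems(2) by (simp flip: sum_distrib_left)
  finally have IH: "(\<Sum>h\<in>?G. (u h)\<^sup>2) \<le> \<mu> * (\<Sum>T\<in>grassmannian W j. (g T)\<^sup>2)"
    using Suc.IH[of g] Suc.prems(1) unfolding u_def \<mu>_def by simp
  \<comment> \<open>Adjointness: the square norm of \<open>g\<close>, the down image of
    \<open>f\<close>, is the inner product of \<open>f\<close> with \<open>u\<close>, the up image
    of \<open>g\<close>.\<close>
  have "(\<Sum>T\<in>grassmannian W j. (g T)\<^sup>2) = (\<Sum>T\<in>grassmannian W j. \<Sum>h | h \<in> ?G \<and> T \<subseteq> h. f h * g T)"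
    by (simp add: power2_eq_square g_def sum_distrib_right)
  also have "\<dots> = (\<Sum>h\<in>?G. \<Sum>T | T \<in> grassmannian W j \<and> T \<subseteq> h. f h * g T)"
    by (rule sum.swap_restrict) auto
  also have "\<dots> = (\<Sum>h\<in>?G. f h * u h)" by (simp add: u_def sum_distrib_left)
  finally have S: "(\<Sum>T\<in>grassmannian W j. (g T)\<^sup>2) = (\<Sum>h\<in>?G. f h * u h)" .
  have "(\<Sum>T\<in>grassmannian W j. (g T)\<^sup>2) \<le> \<mu> * (\<Sum>h\<in>?G. (f h)\<^sup>2)"
    unfolding S by (rule sum_mult_square_le[OF mu IH[unfolded S]]) simp
  then have "(\<Sum>L\<in>grassmannian W (Suc (Suc j)). (\<Sum>h | h \<in> ?G \<and> h \<subseteq> L. f h)\<^sup>2) \<le>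
      (\<mu> + (qnum (dim W - Suc j) - qnum (Suc j))) * (\<Sum>h\<in>?G. (f h)\<^sup>2)"
    using sum_square_up_down[OF W Suc.prems(1), of f] by (simp add: g_def distrib_right)
  moreover have "dim W - Suc j = Suc (dim W - Suc (Suc j))" using Suc.prems(1) by simp
  then have "\<mu> + (qnum (dim W - Suc j) - qnum (Suc j)) = real q * qnum (Suc j) * qnum (dim W - Suc (Suc j))"
    unfolding \<mu>_def by (simp only: qnum_Suc) (simp add: algebra_simps)
  ultimately show ?case by simp
qed


section \<open>Arithmetic of \<open>qnum\<close>\<close>

lemma power_eq_qnum: "real q ^ m = (real q - 1) * qnum m + 1"
  using q_gt_1 by (simp add: gauss_binomial_1[unfolded One_nat_def])

lemma qnum_add: "qnum (m + n) = qnum m + real q ^ m * qnum n"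
  by (simp add: gauss_binomial_1[unfolded One_nat_def] power_add right_diff_distrib flip: add_divide_distrib)

lemma qnum_pos: "m > 0 \<Longrightarrow> qnum m > 0"
  using gauss_binomial_ge_1[OF q_gt_1, of 1 m] by simp

lemma gauss_binomial_absorb:
  assumes "1 \<le> i" "i \<le> k"
  shows "qnum i * gauss_binomial q k i = qnum k * gauss_binomial q (k - 1) (i - 1)"
proof -
  obtain i' k' where ik: "i = Suc i'" "k = Suc k'" using assms by (metis Suc_le_D le_trans One_nat_def)
  have "real q ^ Suc i' \<noteq> 1" using q_gt_1 one_less_power[of "real q" "Suc i'"] by simp
  then show ?thesis unfolding ik
    by (simp add: gauss_binomial_Suc_Suc gauss_binomial_1[unfolded One_nat_def] del: power_Suc)
qed

lemma qnum_step: "j \<le> m \<Longrightarrow> gauss_binomial q m (Suc j) * qnum (Suc j) = gauss_binomial q m j * qnum (m - j)"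
  using gauss_binomial_step[OF q_gt_1, of j m] q_gt_1
  by (simp add: gauss_binomial_1[unfolded One_nat_def] field_simps del: power_Suc)

text \<open>The bound is attained by the subspaces through a fixed line; it follows from the
  Cauchy-Schwarz inequality applied to the numbers of members of \<open>H\<close> below each \<open>L\<close>.\<close>
lemma upper_shadow_density:
  assumes W: "subspace W" and j: "1 \<le> j" "j < dim W"
    and H: "H \<subseteq> grassmannian W j" and G: "G \<subseteq> grassmannian W (Suc j)"
    and shadow: "\<And>h L. h \<in> H \<Longrightarrow> L \<in> grassmannian W (Suc j) \<Longrightarrow> h \<subseteq> L \<Longrightarrow> L \<in> G"
    and dense: "qnum j * gauss_binomial q (dim W) j \<le> real (card H) * qnum (dim W)"
  shows "qnum (Suc j) * gauss_binomial q (dim W) (Suc j) \<le> real (card G) * qnum (dim W)"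
proof -
  let ?k = "dim W"
  let ?G = "grassmannian W j" and ?G' = "grassmannian W (Suc j)"
  define x where "x = real (card H)"
  define N where "N = gauss_binomial q ?k j"
  define N' where "N' = gauss_binomial q ?k (Suc j)"
  define c where "c = qnum j"
  define Y where "Y = qnum (?k - Suc j)"
  define K where "K = qnum ?k"
  \<comment> \<open>\<open>a\<close> counts the subspaces of dimension \<open>j + 1\<close> above a
    given \<open>h\<close>, and \<open>b\<close> those of dimension \<open>j\<close> below a given
    \<open>L\<close>.\<close>
  define a where "a = qnum (?k - j)"
  define b where "b = qnum (Suc j)"
  define n where "n L = real (card {h\<in>H. h \<subseteq> L})" for L
  have a: "a = real q * Y + 1"
    unfolding a_def Y_def using qnum_Suc[of "?k - Suc j"] j by (simp add: Suc_diff_Suc)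
  have b: "b = real q * c + 1" unfolding b_def c_def by (rule qnum_Suc)
  have K: "K = b + ((real q - 1) * b + 1) * Y"
    unfolding K_def b_def Y_def using qnum_add[of "Suc j" "?k - Suc j"] power_eq_qnum[of "Suc j"] j by simp
  have pos: "c > 0" "Y \<ge> 0" "K > 0" "N \<ge> 1" "N' \<ge> 1"
    unfolding c_def Y_def K_def N_def N'_def using j
    by (auto intro!: qnum_pos[simplified] qnum_nonneg[simplified] gauss_binomial_ge_1[OF q_gt_1])
  have q0: "real q > 1" using q_gt_1 by simp
  have abpos: "a \<ge> 1" "b \<ge> 1" using a b pos q0 by auto
  have NN: "N' * b = N * a" unfolding N'_def b_def N_def a_def using qnum_step[of j ?k] j by simp
  have cN: "c * N \<le> x * K" using dense by (simp add: c_def N_def x_def K_def)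
  have x0: "x > 0" 
  proof -
    have "0 < c * N" using pos by simp
    with cN have "0 < x * K" by linarith
    then show ?thesis using pos by (simp add: zero_less_mult_iff)
  qed
  have cards: "real (card ?G) = N" "real (card ?G') = N'"
    using card_grassmannian[OF W] j by (auto simp: N_def N'_def)
  \<comment> \<open>The indicator of \<open>H\<close> minus its mean has sum zero, as
    \<open>up_operator_bound\<close> requires.\<close>
  define f where "f h = (if h \<in> H then 1 else 0) - x / N" for h
  have sumH: "(\<Sum>h\<in>?G. if h \<in> H then 1 else 0) = x"
    using H by (simp add: x_def Int_absorb1 flip: sum.inter_restrict)
  have f0: "(\<Sum>h\<in>?G. f h) = 0"
    unfolding f_def using sumH cards pos by (simp add: sum_subtractf)
  have f2: "(\<Sum>h\<in>?G. (f h)\<^sup>2) = x - x\<^sup>2 / N"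
  proof -
    have "(\<Sum>h\<in>?G. (f h)\<^sup>2) = (\<Sum>h\<in>?G. (if h \<in> H then 1 else 0) * (1 - 2 * (x / N)) + (x / N)\<^sup>2)"
      by (intro sum.cong) (auto simp: f_def power2_eq_square algebra_simps)
    also have "\<dots> = x * (1 - 2 * (x / N)) + N * (x / N)\<^sup>2"
      using sumH cards by (simp add: sum.distrib flip: sum_distrib_right)
    also have "\<dots> = x - x\<^sup>2 / N" using pos by (simp add: field_simps power2_eq_square)
    finally show ?thesis .
  qed
  have Uf: "(\<Sum>h | h \<in> ?G \<and> h \<subseteq> L. f h) = n L - x / N * b" if L: "L \<in> ?G'" for L
  proof -
    have "(\<Sum>h | h \<in> ?G \<and> h \<subseteq> L. if h \<in> H then 1 else (0::real)) = n L"
    proof -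
      have "{h. h \<in> ?G \<and> h \<subseteq> L} \<inter> H = {h\<in>H. h \<subseteq> L}" using H by auto
      then show ?thesis by (simp add: n_def flip: sum.inter_restrict)
    qed
    then show ?thesis using card_cocovers[OF L] by (simp add: f_def sum_subtractf b_def)
  qed
  have sum_n: "(\<Sum>L\<in>?G'. n L) = x * a"
  proof -
    have "(\<Sum>L\<in>?G'. card {h\<in>H. h \<subseteq> L}) = (\<Sum>h\<in>H. card {L\<in>?G'. h \<subseteq> L})"
      by (rule double_count) auto
    then have "(\<Sum>L\<in>?G'. n L) = (\<Sum>h\<in>H. real (card {L\<in>?G'. h \<subseteq> L}))"
      by (simp add: n_def flip: of_nat_sum)
    also have "\<dots> = (\<Sum>h\<in>H. a)"
      using H j by (intro sum.cong refl) (auto simp: a_def card_covers[OF W])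
    finally show ?thesis by (simp add: x_def)
  qed
  have "(\<Sum>L\<in>?G'. (n L - x / N * b)\<^sup>2) \<le> real q * c * Y * (x - x\<^sup>2 / N)"
    using up_operator_bound[OF W j(2) f0] Uf f2 by (simp add: c_def Y_def)
  moreover have "(\<Sum>L\<in>?G'. (n L - x / N * b)\<^sup>2) = (\<Sum>L\<in>?G'. (n L)\<^sup>2) - x\<^sup>2 / N * a * b"
  proof -
    have "(\<Sum>L\<in>?G'. (n L - x / N * b)\<^sup>2) = (\<Sum>L\<in>?G'. (n L)\<^sup>2 - 2 * (x / N * b) * n L + (x / N * b)\<^sup>2)"
      by (intro sum.cong refl) (simp add: power2_eq_square algebra_simps)
    also have "\<dots> = (\<Sum>L\<in>?G'. (n L)\<^sup>2) - 2 * (x / N * b) * (x * a) + N' * (x / N * b)\<^sup>2"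
      by (simp only: sum.distrib sum_subtractf sum_constant cards sum_n flip: sum_distrib_left)
    also have "N' * (x / N * b)\<^sup>2 = (N' * b) * (x / N)\<^sup>2 * b" by (simp add: power2_eq_square)
    also have "\<dots> = x\<^sup>2 / N * a * b" unfolding NN using pos by (simp add: field_simps power2_eq_square)
    finally show ?thesis using pos by (simp add: field_simps power2_eq_square)
  qed
  ultimately have n2: "(\<Sum>L\<in>?G'. (n L)\<^sup>2) \<le> real q * c * Y * (x - x\<^sup>2 / N) + x\<^sup>2 / N * a * b" by simp
  \<comment> \<open>Since \<open>n\<close> is supported on the shadow \<open>G\<close>,
    Cauchy-Schwarz may be applied over \<open>G\<close> alone, which brings in
    \<open>card G\<close>.\<close>
  have n0: "n L = 0" if "L \<in> ?G' - G" for L using that shadow by (auto simp: n_def)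
  have "(\<Sum>L\<in>G. n L) = x * a" "(\<Sum>L\<in>G. (n L)\<^sup>2) = (\<Sum>L\<in>?G'. (n L)\<^sup>2)"
    using G n0 by (auto simp: sum_n[symmetric] intro!: sum.mono_neutral_left)
  then have "(x * a)\<^sup>2 \<le> real (card G) * (\<Sum>L\<in>?G'. (n L)\<^sup>2)"
    using square_sum_le_card_mult_sum_square[of G n] by simp
  also have "\<dots> \<le> real (card G) * (real q * c * Y * (x - x\<^sup>2 / N) + x\<^sup>2 / N * a * b)"
    using n2 by (intro mult_left_mono) auto
  also have "\<dots> = real (card G) * (x / N) * (real q * c * Y * N + x * K)"
  proof -
    \<comment> \<open>This identity turns the coefficient of \<open>x\<^sup>2 / N\<close> into
      \<open>K\<close>.\<close>
    have ab: "a * b = real q * c * Y + K" unfolding K a b by (simp add: algebra_simps)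
    have "real q * c * Y * (x - x\<^sup>2 / N) + x\<^sup>2 / N * a * b = (x / N) * (real q * c * Y * N - real q * c * Y * x + x * (a * b))"
      using pos by (simp add: field_simps power2_eq_square)
    then show ?thesis unfolding ab by (simp add: algebra_simps)
  qed
  \<comment> \<open>The density hypothesis replaces \<open>c * N\<close> by \<open>x * K\<close>;
    then \<open>a = q * Y + 1\<close> collects both terms.\<close>
  also have "\<dots> \<le> real (card G) * (x / N) * (x * K * a)"
  proof -
    have "real q * Y * (c * N) \<le> real q * Y * (x * K)"
      using cN pos q0 by (intro mult_left_mono) auto
    then have "real q * c * Y * N + x * K \<le> x * K * a" unfolding a by (simp add: algebra_simps)
    then show ?thesis using x0 pos by (intro mult_left_mono) auto
  qed
  finally have "(x\<^sup>2 * a) * a \<le> (x\<^sup>2 * a) * (real (card G) * K / N)"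
    by (simp add: power2_eq_square mult_ac)
  moreover have "x\<^sup>2 * a > 0" using x0 abpos by simp
  ultimately have "a \<le> real (card G) * K / N" by (simp only: mult_le_cancel_left_pos)
  then have "N * a \<le> real (card G) * K" using pos by (simp add: field_simps)
  with NN show ?thesis by (simp add: b_def N'_def K_def mult.commute)
qed

text \<open>A larger family would have an upper shadow in dimension \<open>dim W - i\<close> that is too large to cross-intersect it.\<close>
theorem Erdos_Ko_Rado_subspaces:
  assumes W: "subspace W" and i: "1 \<le> i" "2 * i \<le> dim W"
    and H: "H \<subseteq> grassmannian W i"
    and int: "\<And>h h'. h \<in> H \<Longrightarrow> h' \<in> H \<Longrightarrow> h \<inter> h' \<noteq> {0}"
  shows "real (card H) \<le> gauss_binomial q (dim W - 1) (i - 1)"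
proof -
  let ?k = "dim W"
  have K: "qnum ?k > 0" using i by (intro qnum_pos) simp
  have "real (card H) * qnum ?k \<le> qnum i * gauss_binomial q ?k i"
  proof (rule ccontr)
    assume big: "\<not> real (card H) * qnum ?k \<le> qnum i * gauss_binomial q ?k i"
    \<comment> \<open>The members of dimension \<open>j\<close> above \<open>H\<close>; iterating
      \<open>upper_shadow_density\<close> carries the density from \<open>i\<close> to
      \<open>dim W - i\<close>.\<close>
    define G where "G j = {L\<in>grassmannian W j. \<exists>h\<in>H. h \<subseteq> L}" for j
    have "qnum j * gauss_binomial q ?k j \<le> real (card (G j)) * qnum ?k" if "i \<le> j" "j \<le> ?k - i" for j
      using that
    proof (induction rule: dec_induct)
      case base
      have "G i = H"
      proof (intro equalityI subsetI)
        fix L assume "L \<in> G i"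
        then obtain h where h: "h \<in> H" "h \<subseteq> L" "L \<in> grassmannian W i" by (auto simp: G_def)
        then have "h = L" using H by (intro subspace_dim_equal) (auto simp: grassmannian_def)
        with h show "L \<in> H" by simp
      qed (use H in \<open>auto simp: G_def\<close>)
      with big show ?case by simp
    next
      case (step j)
      show ?case
        by (rule upper_shadow_density[OF W, where H = "G j"]) (use step i in \<open>auto simp: G_def\<close>)
    qed
    then have dense: "qnum (?k - i) * gauss_binomial q ?k i \<le> real (card (G (?k - i))) * qnum ?k"
      using i gauss_binomial_symmetric[OF q_gt_1, of i ?k] by simp
    have cross: "h \<inter> g \<noteq> {0}" if hg: "h \<in> H" "g \<in> G (?k - i)" for h g
    proof -
      obtain h' where h': "h' \<in> H" "h' \<subseteq> g" using hg by (auto simp: G_def)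
      have "0 \<in> h" "0 \<in> h'" using H hg h' subspace_0 by (auto simp: grassmannian_def)
      then obtain z where "z \<in> h \<inter> h'" "z \<noteq> 0" using int[OF hg(1) h'(1)] by blast
      with h' show ?thesis by auto
    qed
    have "real (card (G (?k - i))) + real q ^ (?k - i) * real (card H) \<le> gauss_binomial q ?k i"
      by (rule cross_intersecting_bound[OF W i H _ int cross]) (auto simp: G_def)
    then have "(real (card (G (?k - i))) + real q ^ (?k - i) * real (card H)) * qnum ?k \<le> gauss_binomial q ?k i * qnum ?k"
      using K by (intro mult_right_mono) auto
    \<comment> \<open>Splitting \<open>qnum\<close> along \<open>dim W = (dim W - i) + i\<close>
      shows that the cross-intersection bound leaves \<open>H\<close> no more than the density
      assumed to be exceeded.\<close>
    moreover have "qnum ?k = qnum (?k - i) + real q ^ (?k - i) * qnum i"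
      using qnum_add[of "?k - i" i] i by simp
    then have "gauss_binomial q ?k i * qnum ?k = qnum (?k - i) * gauss_binomial q ?k i + real q ^ (?k - i) * (qnum i * gauss_binomial q ?k i)"
      by (simp add: algebra_simps)
    ultimately have "real q ^ (?k - i) * (real (card H) * qnum ?k) \<le> real q ^ (?k - i) * (qnum i * gauss_binomial q ?k i)"
      using dense by (simp add: algebra_simps)
    with big show False using q_gt_1 by simp
  qed
  also have "\<dots> = gauss_binomial q (?k - 1) (i - 1) * qnum ?k"
    using gauss_binomial_absorb[of i ?k] i by (simp add: mult.commute)
  finally show ?thesis using K by simp
qed

end

section \<open>Covering-triple-free families\<close>

locale covering_triple_free_family = finite_field_space scale Basis q
  for scale :: "'a::{field,finite} \<Rightarrow> 'b::ab_group_add \<Rightarrow> 'b" (infixr "*s" 75) and Basis q +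
  fixes k :: nat and F :: "'b set set" and A :: "'b set"
  assumes k: "2 \<le> k" "2 * k \<le> dim UNIV"
    and F_dim: "\<forall>B\<in>F. dim_subspace scale k B"
    and F_free: "covering_triple_free scale k F"
    and A: "A \<in> F"
begin

abbreviation "isol \<equiv> isolated_members F"
abbreviation "idx \<equiv> meet_index scale F A"
abbreviation "partners \<equiv> meet_partners scale F A"
abbreviation "Phi \<equiv> phi scale k F A"
abbreviation "Pinv \<equiv> phi_inv scale k F A"

lemma mem: "B \<in> F \<Longrightarrow> subspace B" "B \<in> F \<Longrightarrow> dim B = k"
  using F_dim by (auto simp: dim_subspace_def)

text \<open>If the two traces on \<open>B\<close> were independent, their dimensions would force
  them to sum to \<open>B\<close>, a covering triple. All uses of the freeness hypothesis go through
  this form.\<close>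

lemma no_covering_triple:
  assumes "B \<in> F" "C \<in> F" "Z \<in> F" "B \<noteq> C" "B \<noteq> Z" "C \<noteq> Z"
    and "k \<le> dim (B \<inter> C) + dim (B \<inter> Z)"
  shows "B \<inter> C \<inter> Z \<noteq> {0}"
proof
  assume "B \<inter> C \<inter> Z = {0}"
  then have Int: "(B \<inter> C) \<inter> (B \<inter> Z) = {0}" by auto
  have "sumset (B \<inter> C) (B \<inter> Z) = B"
    using assms mem Int by (intro Int_0_imp_sumset_eq) (auto intro: subspace_inter)
  then have "is_direct_sum B (B \<inter> C) (B \<inter> Z)"
    using Int by (simp add: is_direct_sum_def)
  then show False
    using F_free F_dim assms by (auto simp: covering_triple_free_def covering_triple_def)
qed

lemma iso_subset: "isol \<subseteq> F"
  by (auto simp: isolated_members_def)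

lemma iso_eqI: "B \<in> isol \<Longrightarrow> C \<in> F \<Longrightarrow> B \<inter> C \<noteq> {0} \<Longrightarrow> C = B"
  by (auto simp: isolated_members_def)

section \<open>Indices and partners of members\<close>

lemma meets_A:
  assumes "A \<inter> B \<noteq> {0}"
  shows "idx B = dim (A \<inter> B)" "partners B = {A}"
  using assms by (auto simp: meet_index_def meet_partners_def)

text \<open>As \<open>k\<close> exceeds the indices in question, a non-isolated \<open>A\<close>
  lies in neither of the two classes to be bounded.\<close>

lemma idx_A: "idx A = k"
proof -
  have "A \<noteq> {0}" using dim_eq_0_iff[OF mem(1)[OF A]] mem(2)[OF A] k by auto
  then show ?thesis using mem(2)[OF A] by (simp add: meet_index_def)
qed

lemma finite_meet_dims: "finite {dim (B \<inter> C) | C. C \<in> F \<and> B \<inter> C \<noteq> {0}}"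
  by (rule finite_subset[of _ "(\<lambda>C. dim (B \<inter> C)) ` F"]) auto

lemma idx_min:
  assumes "A \<inter> B = {0}" "C \<in> F" "B \<inter> C \<noteq> {0}"
  shows "idx B \<le> dim (B \<inter> C)"
  using assms by (auto simp: meet_index_def intro!: Min_le finite_meet_dims)

lemma dim_Int_less:
  assumes "B \<in> F" "C \<in> F" "B \<noteq> C"
  shows "dim (B \<inter> C) < k"
proof (rule ccontr)
  assume "\<not> dim (B \<inter> C) < k"
  then have "B \<inter> C = B" "B \<inter> C = C"
    using assms mem by (intro subspace_dim_equal subspace_inter; simp)+
  with assms(3) show False by simp
qed

lemma partner_exists:
  assumes B: "B \<in> F" "B \<notin> isol" "B \<noteq> A"
  obtains C where "C \<in> partners B"
proof (cases "A \<inter> B = {0}")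
  case True
  let ?S = "{dim (B \<inter> C) | C. C \<in> F \<and> B \<inter> C \<noteq> {0}}"
  obtain C where "C \<in> F" "B \<inter> C \<noteq> {0}" using B by (auto simp: isolated_members_def)
  then have "?S \<noteq> {}" by blast
  then have "Min ?S \<in> ?S" using finite_meet_dims by (intro Min_in)
  then obtain C where "Min ?S = dim (B \<inter> C) \<and> C \<in> F \<and> B \<inter> C \<noteq> {0}"
    unfolding mem_Collect_eq by (elim exE)
  then have "C \<in> partners B" using True by (auto simp: meet_partners_def meet_index_def)
  then show ?thesis by (rule that)
qed (use meets_A that in auto)

lemma idx_bounds:
  assumes B: "B \<in> F" "B \<notin> isol" "B \<noteq> A"
  shows "1 \<le> idx B" "idx B < k"
proof -
  show "1 \<le> idx B"
  proof (cases "A \<inter> B = {0}")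
    case True
    let ?S = "{dim (B \<inter> C) | C. C \<in> F \<and> B \<inter> C \<noteq> {0}}"
    obtain C where "C \<in> F" "B \<inter> C \<noteq> {0}" using B by (auto simp: isolated_members_def)
    then have "?S \<noteq> {}" by blast
    then have "Min ?S \<in> ?S" using finite_meet_dims by (intro Min_in)
    then obtain C where C: "Min ?S = dim (B \<inter> C) \<and> C \<in> F \<and> B \<inter> C \<noteq> {0}"
      unfolding mem_Collect_eq by (elim exE)
    then have "dim (B \<inter> C) > 0" using mem B by (intro dim_pos subspace_inter) auto
    with C show ?thesis using True unfolding meet_index_def by simp
  next
    case False
    then have "dim (A \<inter> B) > 0" using mem A B by (intro dim_pos subspace_inter) auto
    with meets_A(1)[OF False] show ?thesis by simp
  qed
  show "idx B < k"
  proof (cases "A \<inter> B = {0}")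
    case True
    obtain C where C: "C \<in> F" "C \<noteq> B" "B \<inter> C \<noteq> {0}" using B by (auto simp: isolated_members_def)
    then show ?thesis using idx_min[OF True C(1,3)] dim_Int_less[of B C] B by simp
  next
    case False
    then show ?thesis using meets_A(1)[OF False] dim_Int_less[of A B] A B by simp
  qed
qed

lemma partner_props:
  assumes B: "B \<in> F" "B \<notin> isol" "B \<noteq> A" and C: "C \<in> partners B"
  shows "C \<in> F" "C \<noteq> B" "dim (B \<inter> C) = idx B"
proof -
  show d: "dim (B \<inter> C) = idx B" and "C \<in> F"
    using C A by (auto simp: meet_partners_def meet_index_def Int_commute split: if_splits)
  show "C \<noteq> B" using d idx_bounds(2)[OF B] mem(2)[OF B(1)] by auto
qed

text \<open>The parameter is the index of the members whose \<open>Phi\<close> can contain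
  \<open>D\<close>; the dimension of \<open>D\<close> is the complementary number
  \<open>k - j\<close>.\<close>

definition transversal :: "nat \<Rightarrow> 'b set \<Rightarrow> bool" where
  "transversal j D \<longleftrightarrow> 1 \<le> j \<and> j < k \<and> subspace D \<and> dim D = k - j \<and> D \<inter> A = {0}"

lemma transversal_nontrivial:
  assumes "transversal j D" "D \<subseteq> B"
  shows "B \<noteq> {0}"
proof
  assume "B = {0}"
  then have "D = {0}" using assms subspace_0 by (auto simp: transversal_def)
  with assms show False by (auto simp: transversal_def)
qed

text \<open>\<open>A\<close> drops out because \<open>D\<close> is nonzero and avoids it. For a
  non-isolated \<open>B\<close> the index is read off from \<open>dim D = k - idx B\<close>, which
  is unambiguous since \<open>idx B < k\<close>.\<close>

lemma phi_invD:
  assumes D: "transversal j D" and B: "B \<in> Pinv D"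
  shows "B \<in> F" "B \<noteq> A" "D \<subseteq> B"
    and "B \<notin> isol \<Longrightarrow> idx B = j \<and> (\<exists>C\<in>partners B. D \<inter> C = {0})"
proof -
  have B': "B \<in> F" "D \<in> Phi B" using B by (auto simp: phi_inv_def)
  show "B \<in> F" "D \<subseteq> B" using B' by (auto simp: phi_def split: if_splits)
  show BA: "B \<noteq> A"
  proof
    assume "B = A"
    then have "D \<subseteq> A" using \<open>D \<subseteq> B\<close> by simp
    then have "D \<inter> A = D" by auto
    then show False using transversal_nontrivial[OF D order_refl] D by (simp add: transversal_def)
  qed
  show "idx B = j \<and> (\<exists>C\<in>partners B. D \<inter> C = {0})" if "B \<notin> isol"
  proof -
    have "dim D = k - idx B" "\<exists>C\<in>partners B. D \<inter> C = {0}"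
      using B' that by (auto simp: phi_def dim_subspace_def)
    then show ?thesis using idx_bounds[OF B'(1) that BA] D by (auto simp: transversal_def)
  qed
qed

lemma phi_invE:
  assumes D: "transversal j D" and B: "B \<in> Pinv D" "B \<notin> isol"
  obtains C where "C \<in> partners B" "C \<in> F" "C \<noteq> B" "dim (B \<inter> C) = j" "D \<inter> C = {0}" "idx B = j"
proof -
  obtain C where "C \<in> partners B" "D \<inter> C = {0}" "idx B = j" using phi_invD(4)[OF D B] by blast
  with partner_props[of B C] phi_invD(1,2)[OF D B(1)] B(2) show ?thesis by (intro that) auto
qed

lemma phi_inv_iso:
  assumes D: "transversal j D" and B: "B \<in> Pinv D" "B \<in> isol" and B': "B' \<in> F" "D \<subseteq> B'"
  shows "B' = B"
proof -
  have "B \<inter> B' \<noteq> {0}" using phi_invD(3)[OF D B(1)] B' by (intro transversal_nontrivial[OF D]) auto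
  then show ?thesis using B B' by (intro iso_eqI)
qed

lemma phi_inv_iso_eq:
  assumes D: "transversal j D" and B: "B \<in> Pinv D" "B \<in> isol"
  shows "Pinv D = {B}"
  using phi_inv_iso[OF D B] phi_invD[OF D] B by blast

text \<open>Otherwise \<open>B \<inter> B' = D\<close>, and as \<open>B\<close> is the direct sum of
  \<open>D\<close> and \<open>B \<inter> C\<close> for its partner \<open>C\<close>, the spaces
  \<open>B\<close>, \<open>B'\<close>, \<open>C\<close> would be a covering triple.\<close>

lemma phi_inv_Int_dim:
  assumes D: "transversal j D" and B: "B \<in> Pinv D" "B \<notin> isol" and B': "B' \<in> F" "D \<subseteq> B'" "B' \<noteq> B"
  shows "k - j < dim (B \<inter> B')"
proof (rule ccontr)
  assume le: "\<not> k - j < dim (B \<inter> B')"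
  obtain C where C: "C \<in> F" "C \<noteq> B" "dim (B \<inter> C) = j" "D \<inter> C = {0}"
    using phi_invE[OF D B] by metis
  have BF: "B \<in> F" "D \<subseteq> B" using phi_invD[OF D B(1)] by auto
  have sub: "subspace B" "subspace B'" "subspace D" "dim D = k - j" "j < k"
    using BF B' mem D by (auto simp: transversal_def)
  have eq: "D = B \<inter> B'"
    using le sub BF B' by (intro subspace_dim_equal subspace_inter) auto
  have "C \<noteq> B'"
  proof
    assume "C = B'"
    then have "D = {0}" using C(4) B'(2) by auto
    then show False using sub by simp
  qed
  then have "B \<inter> B' \<inter> C \<noteq> {0}"
    using sub C BF B' eq by (intro no_covering_triple) auto
  then show False using C(4) eq by simp
qed

section \<open>Common partners and their traces\<close>

definition common_partner :: "nat \<Rightarrow> 'b set \<Rightarrow> 'b set \<Rightarrow> bool" where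
  "common_partner j D C \<longleftrightarrow> C \<in> F \<and> D \<inter> C = {0} \<and> (\<forall>B\<in>Pinv D. dim (B \<inter> C) = j)"

lemma dim_Int_complement_le:
  assumes D: "transversal j D" and B: "B \<in> F" "D \<subseteq> B" and C: "C \<in> F" "D \<inter> C = {0}"
  shows "dim (B \<inter> C) \<le> j"
proof -
  have "dim D + dim (B \<inter> C) \<le> dim B + dim (D \<inter> (B \<inter> C))"
    using D B C mem by (intro dim_Int_ge subspace_inter) (auto simp: transversal_def)
  moreover have "D \<inter> (B \<inter> C) = {0}" using B C by auto
  ultimately show ?thesis using D mem(2)[OF B(1)] by (simp add: transversal_def)
qed

lemma Int_Int_nontrivial:
  assumes "B \<in> F" "Z \<in> F" "C \<in> F" "k < dim (B \<inter> Z) + dim (B \<inter> C)"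
  shows "B \<inter> Z \<inter> C \<noteq> {0}"
proof -
  have "(B \<inter> Z) \<inter> (B \<inter> C) \<noteq> {0}"
    using assms mem by (intro Int_nontrivial[of _ _ B] subspace_inter) auto
  moreover have "(B \<inter> Z) \<inter> (B \<inter> C) = B \<inter> Z \<inter> C" by auto
  ultimately show ?thesis by simp
qed

lemma nontrivial_superset:
  assumes "B \<in> F" "Z \<in> F" "C \<in> F" "B \<inter> Z \<inter> C \<noteq> {0}" "B \<inter> Z \<inter> C \<subseteq> T"
  shows "T \<noteq> {0}"
proof -
  have "0 \<in> B \<inter> Z \<inter> C" using assms(1-3) mem(1) by (simp add: subspace_0)
  with assms(4,5) show ?thesis by blast
qed

text \<open>Every other \<open>B\<close> shares more than \<open>k - j\<close> dimensions with
  \<open>B0\<close>, so it meets \<open>C\<close>. Minimality of the index gives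
  \<open>j \<le> dim (B \<inter> C)\<close>, and \<open>D \<inter> C = {0}\<close> gives the
  reverse; if \<open>A\<close> meets \<open>B0\<close>, then \<open>C = A\<close> and the index of
  \<open>B\<close> is the dimension itself.\<close>

lemma common_partnerI:
  assumes D: "transversal j D" and noniso: "Pinv D \<inter> isol = {}"
    and B0: "B0 \<in> Pinv D" "C \<in> partners B0" "D \<inter> C = {0}"
  shows "common_partner j D C"
  unfolding common_partner_def
proof (intro conjI ballI)
  have B0': "B0 \<in> F" "B0 \<notin> isol" "B0 \<noteq> A" "D \<subseteq> B0" "idx B0 = j"
    using B0 noniso phi_invD[OF D B0(1)] by blast+
  have C: "C \<in> F" "C \<noteq> B0" "dim (B0 \<inter> C) = j" using partner_props[OF B0'(1-3) B0(2)] B0' by auto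
  show "C \<in> F" "D \<inter> C = {0}" by fact+
  fix B assume B: "B \<in> Pinv D"
  have B': "B \<in> F" "B \<notin> isol" "B \<noteq> A" "D \<subseteq> B" "idx B = j"
    using B noniso phi_invD[OF D B] by auto
  show "dim (B \<inter> C) = j"
  proof (cases "B = B0")
    case False
    have gt: "k - j < dim (B0 \<inter> B)"
      using phi_inv_Int_dim[OF D B0(1) B0'(2) B'(1,4) False] .
    then have "B0 \<inter> B \<inter> C \<noteq> {0}" using B' B0' C by (intro Int_Int_nontrivial) auto
    then have BC: "B \<inter> C \<noteq> {0}" by (rule nontrivial_superset[OF B0'(1) B'(1) C(1)]) auto
    show ?thesis
    proof (cases "A \<inter> B0 = {0}")
      case True
      \<comment> \<open>The same dimension argument with the roles of \<open>B\<close> and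
        \<open>B0\<close> exchanged and \<open>A\<close> in place of \<open>C\<close>. It ensures
        that the index of \<open>B\<close> is a minimum.\<close>
      have "A \<inter> B = {0}"
      proof (rule ccontr)
        assume ne: "A \<inter> B \<noteq> {0}"
        then have "dim (B \<inter> A) = j" using meets_A(1)[OF ne] B' by (simp add: Int_commute)
        then have "B \<inter> B0 \<inter> A \<noteq> {0}" using gt B' B0' A
          by (intro Int_Int_nontrivial) (auto simp: Int_commute)
        then have "A \<inter> B0 \<noteq> {0}" by (rule nontrivial_superset[OF B'(1) B0'(1) A]) auto
        with True show False by simp
      qed
      then have "j \<le> dim (B \<inter> C)" using idx_min[OF _ C(1) BC] B' by simp
      with dim_Int_complement_le[OF D B'(1,4) C(1) B0(3)] show ?thesis by simp
    next
      case ne: False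
      then have "C = A" using meets_A(2) B0(2) by auto
      then have "A \<inter> B \<noteq> {0}" using BC by (simp add: Int_commute)
      then show ?thesis using meets_A(1)[of B] B' \<open>C = A\<close> by (simp add: Int_commute)
    qed
  qed (use C in simp)
qed

lemma common_partner_exists:
  assumes D: "transversal j D" and noniso: "Pinv D \<inter> isol = {}" and ne: "Pinv D \<noteq> {}"
  obtains C where "common_partner j D C"
proof -
  obtain B where B: "B \<in> Pinv D" using ne by blast
  then obtain C where "C \<in> partners B" "D \<inter> C = {0}" using phi_invD(4)[OF D B] noniso by blast
  then show ?thesis using common_partnerI[OF D noniso B] that by blast
qed

text \<open>The trace determines \<open>B\<close> as the sum of \<open>D\<close> and
  \<open>B \<inter> C\<close>. Two members share more than \<open>k - j\<close> dimensions, so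
  inside one of them this intersection meets the \<open>j\<close>-dimensional trace.\<close>

lemma common_partner_traces:
  assumes D: "transversal j D" and noniso: "Pinv D \<inter> isol = {}" and C: "common_partner j D C"
  shows "inj_on (\<lambda>B. B \<inter> C) (Pinv D)" "(\<lambda>B. B \<inter> C) ` Pinv D \<subseteq> grassmannian C j"
    and "\<And>B B'. B \<in> Pinv D \<Longrightarrow> B' \<in> Pinv D \<Longrightarrow> (B \<inter> C) \<inter> (B' \<inter> C) \<noteq> {0}"
proof -
  have C': "C \<in> F" "D \<inter> C = {0}" "\<And>B. B \<in> Pinv D \<Longrightarrow> dim (B \<inter> C) = j"
    using C by (auto simp: common_partner_def)
  have j: "1 \<le> j" "j < k" "subspace D" "dim D = k - j" using D by (auto simp: transversal_def)
  show "inj_on (\<lambda>B. B \<inter> C) (Pinv D)"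
  proof (rule inj_onI)
    have *: "sumset D (B \<inter> C) = B" if "B \<in> Pinv D" for B
    proof (rule Int_0_imp_sumset_eq)
      show "D \<inter> (B \<inter> C) = {0}" using C'(2) phi_invD(3)[OF D that] by auto
    qed (use mem C' j phi_invD[OF D that] that in \<open>auto intro: subspace_inter\<close>)
    fix B B' assume "B \<in> Pinv D" "B' \<in> Pinv D" "B \<inter> C = B' \<inter> C"
    then show "B = B'" using *[of B] *[of B'] by simp
  qed
  show "(\<lambda>B. B \<inter> C) ` Pinv D \<subseteq> grassmannian C j"
    using C' mem phi_invD(1)[OF D] by (auto simp: grassmannian_def intro: subspace_inter)
  fix B B' assume B: "B \<in> Pinv D" and B': "B' \<in> Pinv D"
  have F: "B \<in> F" "B' \<in> F" "D \<subseteq> B'" "B \<notin> isol" using phi_invD[OF D] B B' noniso by auto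
  show "(B \<inter> C) \<inter> (B' \<inter> C) \<noteq> {0}"
  proof (cases "B = B'")
    case True
    then show ?thesis using C'(3)[OF B] j dim_eq_0_iff by force
  next
    case False
    then have "k - j < dim (B \<inter> B')" using phi_inv_Int_dim[OF D B F(4,2,3)] by blast
    then have "B \<inter> B' \<inter> C \<noteq> {0}" using C'(3)[OF B] F C'(1) by (intro Int_Int_nontrivial) auto
    then show ?thesis by (rule nontrivial_superset[OF F(1,2) C'(1)]) auto
  qed
qed

text \<open>An isolated member is alone over \<open>D\<close>. Otherwise \<open>Pinv D\<close>
  injects into the \<open>j\<close>-dimensional subspaces of a common partner, as an intersecting
  family to which the Erdos-Ko-Rado theorem applies when \<open>2 * j \<le> k\<close>.\<close>

lemma card_phi_inv_le:
  assumes D: "transversal j D"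
  shows "real (card (Pinv D)) \<le> gauss_binomial q k j"
    and "2 * j \<le> k \<Longrightarrow> real (card (Pinv D)) \<le> gauss_binomial q (k - 1) (j - 1)"
proof -
  have j: "1 \<le> j" "j < k" using D by (auto simp: transversal_def)
  have ge1: "gauss_binomial q k j \<ge> 1" "gauss_binomial q (k - 1) (j - 1) \<ge> 1"
    using j by (auto intro!: gauss_binomial_ge_1[OF q_gt_1])
  consider "Pinv D = {}" | B where "B \<in> Pinv D" "B \<in> isol" | "Pinv D \<noteq> {}" "Pinv D \<inter> isol = {}" by blast
  then have "real (card (Pinv D)) \<le> gauss_binomial q k j \<and>
      (2 * j \<le> k \<longrightarrow> real (card (Pinv D)) \<le> gauss_binomial q (k - 1) (j - 1))"
  proof cases
    case 2
    then show ?thesis using phi_inv_iso_eq[OF D 2] ge1 by simp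
  next
    case 3
    obtain C where C: "common_partner j D C" using common_partner_exists[OF D 3(2,1)] .
    then have "C \<in> F" by (simp add: common_partner_def)
    then have Cs: "subspace C" "dim C = k" using mem by auto
    note tr = common_partner_traces[OF D 3(2) C]
    have card: "card (Pinv D) = card ((\<lambda>B. B \<inter> C) ` Pinv D)" using tr(1) by (simp add: card_image)
    have "real (card (Pinv D)) \<le> gauss_binomial q k j"
      unfolding card using card_mono[OF _ tr(2)] card_grassmannian[of C j] Cs j by simp
    moreover have "real (card (Pinv D)) \<le> gauss_binomial q (k - 1) (j - 1)" if "2 * j \<le> k"
      unfolding card using Erdos_Ko_Rado_subspaces[OF Cs(1) j(1) _ tr(2)] tr(3) that Cs by auto
    ultimately show ?thesis by blast
  qed (use ge1 in auto)
  then show "real (card (Pinv D)) \<le> gauss_binomial q k j"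
    and "2 * j \<le> k \<Longrightarrow> real (card (Pinv D)) \<le> gauss_binomial q (k - 1) (j - 1)" by auto
qed

text \<open>A partner \<open>C\<close> shared by the members over \<open>D'\<close> also serves those over \<open>D\<close>, and the traces
  of both families on \<open>C\<close> cross-intersect.\<close>
lemma card_phi_inv_pair:
  assumes i: "1 \<le> i" "2 * i < k" and D: "transversal (k - i) D" and D': "transversal i D'"
    and sub: "D \<subseteq> D'"
  shows "real (card (Pinv D)) \<le> gauss_binomial q (k - 1) i \<or>
    real (card (Pinv D)) + real q ^ (k - i) * real (card (Pinv D')) \<le> gauss_binomial q k i"
proof (cases "card (Pinv D) \<le> 1 \<or> Pinv D' = {}")
  case True
  have "gauss_binomial q (k - 1) i \<ge> 1" using i by (intro gauss_binomial_ge_1[OF q_gt_1]) simp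
  moreover have "gauss_binomial q k (k - i) = gauss_binomial q k i"
    using gauss_binomial_symmetric[OF q_gt_1, of i k] i by simp
  ultimately show ?thesis using True card_phi_inv_le(1)[OF D] by auto
next
  case False
  \<comment> \<open>With two members over \<open>D\<close>, no \<open>B\<close> can be the only
    member of \<open>F\<close> containing \<open>D\<close>; this rules out isolated members over
    \<open>D\<close> and over \<open>D'\<close>.\<close>
  have uniq: False if B: "B \<in> Pinv D" "\<And>B'. B' \<in> F \<Longrightarrow> D \<subseteq> B' \<Longrightarrow> B' = B" for B
  proof -
    have "Pinv D \<subseteq> {B}" using B phi_invD[OF D] by blast
    then have "card (Pinv D) \<le> 1" using card_mono[of "{B}"] by simp
    with False show False by simp
  qed
  have noniso: "Pinv D \<inter> isol = {}" using uniq phi_inv_iso[OF D] by blast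
  obtain Z where Z: "Z \<in> Pinv D'" using False by blast
  have noniso': "Pinv D' \<inter> isol = {}"
  proof (rule ccontr)
    assume "Pinv D' \<inter> isol \<noteq> {}"
    then obtain Y where Y: "Y \<in> Pinv D'" "Y \<in> isol" by blast
    have DY: "D \<subseteq> Y" using sub phi_invD(3)[OF D' Y(1)] by blast
    have YF: "Y \<in> F" using Y iso_subset by blast
    obtain B where B: "B \<in> Pinv D" using False by fastforce
    have eq: "B' = Y" if "B' \<in> F" "D \<subseteq> B'" for B'
      using iso_eqI[OF Y(2) that(1)] transversal_nontrivial[OF D, of "Y \<inter> B'"] DY that by blast
    then have "B = Y" using phi_invD[OF D B] by blast
    then show False using uniq[OF B] eq by blast
  qed
  have ZF: "Z \<in> F" "Z \<noteq> A" "D' \<subseteq> Z" "Z \<notin> isol" using phi_invD[OF D' Z] noniso' Z by auto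
  obtain C where C: "C \<in> partners Z" "C \<in> F" "C \<noteq> Z" "dim (Z \<inter> C) = i" "D' \<inter> C = {0}" "idx Z = i"
    using phi_invE[OF D' Z ZF(4)] by metis
  have cp': "common_partner i D' C" by (rule common_partnerI[OF D' noniso' Z C(1,5)])
  have DC: "D \<inter> C = {0}" using C(5) sub D D' C(2) mem subspace_0 by (auto simp: transversal_def)
  have Bprops: "B \<in> F" "B \<notin> isol" "D \<subseteq> B" "idx B = k - i" "B \<noteq> A" if "B \<in> Pinv D" for B
    using phi_invD[OF D that] noniso that by auto
  have ne: "B \<noteq> Y" if "B \<in> Pinv D" "Y \<in> Pinv D'" for B Y
  proof
    assume "B = Y"
    have "Y \<notin> isol" using noniso' that by blast
    then have "idx Y = i" using phi_invD(4)[OF D' that(2)] by blast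
    with \<open>B = Y\<close> show False using Bprops(4)[OF that(1)] i by simp
  qed
  have dimBC: "dim (B \<inter> C) = k - i" if B: "B \<in> Pinv D" for B
  proof (cases "A \<inter> B = {0}")
    case nontriv: False
    have "dim (B \<inter> A) = k - i" using meets_A(1)[OF nontriv] Bprops[OF B] by (simp add: Int_commute)
    moreover have "k - (k - i) < dim (B \<inter> Z)"
      using phi_inv_Int_dim[OF D B _ ZF(1)] Bprops[OF B] ZF sub ne[OF B Z] by auto
    ultimately have "B \<inter> Z \<inter> A \<noteq> {0}" using Bprops[OF B] ZF A i by (intro Int_Int_nontrivial) auto
    then have "A \<inter> Z \<noteq> {0}" by (rule nontrivial_superset[OF Bprops(1)[OF B] ZF(1) A]) auto
    then have "C = A" using C(1) meets_A(2) by auto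
    with \<open>dim (B \<inter> A) = k - i\<close> show ?thesis by simp
  next
    case triv: True
    have "B \<inter> Z \<noteq> {0}" using Bprops[OF B] ZF sub by (intro transversal_nontrivial[OF D]) auto
    \<comment> \<open>Here the index of \<open>B\<close> is a minimum and \<open>Z\<close> meets
      \<open>B\<close> in \<open>D\<close>. Together with \<open>dim (Z \<inter> C) = i\<close> this
      suffices to apply \<open>no_covering_triple\<close> inside \<open>Z\<close>.\<close>
    then have "k - i \<le> dim (B \<inter> Z)" using idx_min[OF triv ZF(1)] Bprops[OF B] by simp
    moreover have "C \<noteq> B"
      using DC Bprops(3)[OF B] transversal_nontrivial[OF D order_refl] by auto
    ultimately have "Z \<inter> B \<inter> C \<noteq> {0}"
      using ZF Bprops[OF B] C ne[OF B Z] i by (intro no_covering_triple) (auto simp: Int_commute)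
    then have "B \<inter> C \<noteq> {0}" by (rule nontrivial_superset[OF ZF(1) Bprops(1)[OF B] C(2)]) auto
    then have "k - i \<le> dim (B \<inter> C)" using idx_min[OF triv C(2)] Bprops[OF B] by simp
    moreover have "dim (B \<inter> C) \<le> k - i"
      using dim_Int_complement_le[OF D Bprops(1)[OF B] Bprops(3)[OF B] C(2) DC] by simp
    ultimately show ?thesis by simp
  qed
  have cp: "common_partner (k - i) D C" using C(2) DC dimBC by (simp add: common_partner_def)
  let ?t = "\<lambda>B. B \<inter> C"
  note tr = common_partner_traces[OF D noniso cp] and tr' = common_partner_traces[OF D' noniso' cp']
  have cross: "h \<inter> g \<noteq> {0}" if hg: "h \<in> ?t ` Pinv D'" "g \<in> ?t ` Pinv D" for h g
  proof -
    obtain Y B where YB: "Y \<in> Pinv D'" "B \<in> Pinv D" "h = Y \<inter> C" "g = B \<inter> C" using hg by auto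
    have YF: "Y \<in> F" "D' \<subseteq> Y" using phi_invD[OF D' YB(1)] by auto
    have "dim (Y \<inter> C) = i" using cp' YB by (auto simp: common_partner_def)
    moreover have "C \<noteq> Y"
      using C(5) YF(2) transversal_nontrivial[OF D' order_refl] by auto
    moreover have "C \<noteq> B"
      using DC Bprops(3)[OF YB(2)] transversal_nontrivial[OF D order_refl] by auto
    \<comment> \<open>Now \<open>C\<close> is the space that would be covered: the traces of
      \<open>Y\<close> and \<open>B\<close> have dimensions \<open>i\<close> and
      \<open>k - i\<close>.\<close>
    ultimately have "C \<inter> Y \<inter> B \<noteq> {0}"
      using YF Bprops[OF YB(2)] C ne[OF YB(2,1)] dimBC[OF YB(2)] i
      by (intro no_covering_triple) (auto simp: Int_commute)
    then show ?thesis
      by (rule nontrivial_superset[OF C(2) YF(1) Bprops(1)[OF YB(2)]]) (auto simp: YB)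
  qed
  have "real (card (?t ` Pinv D)) + real q ^ (dim C - i) * real (card (?t ` Pinv D')) \<le> gauss_binomial q (dim C) i"
  proof (rule cross_intersecting_bound[OF mem(1)[OF C(2)] i(1) _ tr'(2)])
    show "2 * i \<le> dim C" using i mem(2)[OF C(2)] by simp
    show "?t ` Pinv D \<subseteq> grassmannian C (dim C - i)" using tr(2) mem(2)[OF C(2)] by simp
    show "h \<inter> h' \<noteq> {0}" if "h \<in> ?t ` Pinv D'" "h' \<in> ?t ` Pinv D'" for h h'
      using that tr'(3) by auto
  qed (rule cross)
  then show ?thesis using tr(1) tr'(1) mem(2)[OF C(2)] by (simp add: card_image)
qed

end

section \<open>The averaging argument\<close>

context covering_triple_free_family begin

section \<open>Counting transversal subspaces\<close>

definition trans_set :: "nat \<Rightarrow> 'b set set" where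
  "trans_set j = {D. transversal j D}"

abbreviation "cls j \<equiv> index_class scale F A j"

lemma trans_set_eq:
  assumes "1 \<le> j" "j < k"
  shows "trans_set j = subspaces_avoiding UNIV {0} A (k - j)"
  using assms subspace_0 by (auto simp: trans_set_def transversal_def subspaces_avoiding_def)

lemma card_trans_set:
  assumes "1 \<le> j" "j < k"
  shows "real (card (trans_set j)) = real q ^ (k * (k - j)) * gauss_binomial q (dim UNIV - k) (k - j)"
  using card_subspaces_avoiding[of UNIV "{0}" A "k - j"] assms k mem[OF A] subspace_0[OF mem(1)[OF A]]
  by (simp add: trans_set_eq subspace_single_0)

text \<open>Together with \<open>card_trans_set_below\<close> this makes inclusion between
  transversal subspaces of two dimensions biregular, so that averages over pairs are averages over
  each side.\<close>

lemma card_trans_set_above: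
  assumes D: "transversal j D" and j': "1 \<le> j'" "j' \<le> j"
  shows "real (card {D'\<in>trans_set j'. D \<subseteq> D'}) =
    real q ^ (k * (j - j')) * gauss_binomial q (dim UNIV - 2 * k + j) (j - j')"
proof -
  have D': "subspace D" "dim D = k - j" "D \<inter> A = {0}" "j < k" using D by (auto simp: transversal_def)
  have "{D'\<in>trans_set j'. D \<subseteq> D'} = subspaces_avoiding UNIV D A (k - j')"
    using j' D' by (auto simp: trans_set_def transversal_def subspaces_avoiding_def)
  moreover have "k - j' - (k - j) = j - j'" "dim UNIV - k - (k - j) = dim UNIV - 2 * k + j" using j' D' k by auto
  ultimately show ?thesis
    using card_subspaces_avoiding[of UNIV D A "k - j'"] D' j' k mem[OF A] by (simp add: Int_commute)
qed

lemma card_trans_set_below: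
  assumes D': "transversal j' D'" and j: "j' \<le> j" "j < k"
  shows "real (card {D\<in>trans_set j. D \<subseteq> D'}) = gauss_binomial q (k - j') (k - j)"
proof -
  have D'': "subspace D'" "dim D' = k - j'" "D' \<inter> A = {0}" "1 \<le> j'" using D' by (auto simp: transversal_def)
  have "D \<inter> A = {0}" if "subspace D" "D \<subseteq> D'" for D
    using that D''(3) subspace_0[OF that(1)] subspace_0[OF mem(1)[OF A]] by auto
  then have "{D\<in>trans_set j. D \<subseteq> D'} = grassmannian D' (k - j)"
    using j D'' by (auto simp: trans_set_def transversal_def grassmannian_def)
  then show ?thesis using card_grassmannian[of D' "k - j"] D'' j by simp
qed

lemma sum_card_phi_inv:
  "(\<Sum>D\<in>trans_set j. card (Pinv D)) = (\<Sum>B\<in>F. card (Phi B \<inter> trans_set j))"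
proof -
  have "(\<Sum>D\<in>trans_set j. card {B\<in>F. D \<in> Phi B}) = (\<Sum>B\<in>F. card {D\<in>trans_set j. D \<in> Phi B})"
    by (rule double_count) auto
  moreover have "{D\<in>trans_set j. D \<in> Phi B} = Phi B \<inter> trans_set j" for B by auto
  ultimately show ?thesis by (simp add: phi_inv_def)
qed

lemma index_class_subset: "cls j \<subseteq> F"
  using iso_subset by (auto simp: index_class_def)

text \<open>If \<open>A\<close> meets \<open>B\<close>, then \<open>A\<close> is the only partner
  and \<open>D\<close> avoids it by definition; otherwise \<open>D \<subseteq> B\<close> avoids
  \<open>A\<close> anyway.\<close>

lemma phi_subset_trans_set:
  assumes B: "B \<in> F" "B \<notin> isol" "B \<noteq> A"
  shows "Phi B \<subseteq> trans_set (idx B)"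
proof
  fix D assume "D \<in> Phi B"
  then obtain C where D: "subspace D" "dim D = k - idx B" "D \<subseteq> B" "C \<in> partners B" "D \<inter> C = {0}"
    using B by (auto simp: phi_def dim_subspace_def)
  have "D \<inter> A = {0}"
  proof (cases "A \<inter> B = {0}")
    case True
    then show ?thesis using D subspace_0[OF D(1)] by auto
  next
    case False
    then show ?thesis using D meets_A(2) by auto
  qed
  then show "D \<in> trans_set (idx B)"
    using D idx_bounds[OF B] by (simp add: trans_set_def transversal_def)
qed

text \<open>\<open>Phi B\<close> contains all complements in \<open>B\<close> of the trace of any
  one partner.\<close>

lemma card_phi_ge:
  assumes B: "B \<in> F" "B \<notin> isol" "B \<noteq> A"
  shows "q ^ (idx B * (k - idx B)) \<le> card (Phi B)"
proof -
  obtain C where C: "C \<in> partners B" using partner_exists[OF B] .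
  note Cp = partner_props[OF B C]
  have "{D\<in>grassmannian B (dim B - dim (B \<inter> C)). D \<inter> (B \<inter> C) = {0}} \<subseteq> Phi B"
  proof
    fix D assume D: "D \<in> {D\<in>grassmannian B (dim B - dim (B \<inter> C)). D \<inter> (B \<inter> C) = {0}}"
    then have "D \<inter> C = {0}" by (auto simp: grassmannian_def)
    then show "D \<in> Phi B"
      using D C Cp B mem by (auto simp: phi_def dim_subspace_def grassmannian_def)
  qed
  then have "card {D\<in>grassmannian B (dim B - dim (B \<inter> C)). D \<inter> (B \<inter> C) = {0}} \<le> card (Phi B)"
    by (intro card_mono) auto
  then show ?thesis
    using card_complements[of B "B \<inter> C"] Cp B mem by (simp add: subspace_inter)
qed

lemma gauss_binomial_gt_power:
  assumes "1 \<le> j" "j < m"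
  shows "gauss_binomial q m j \<ge> real q ^ (j * (m - j)) + 1"
proof -
  obtain j' m' where jm: "j = Suc j'" "m = Suc m'" using assms by (metis Suc_le_D One_nat_def less_imp_Suc_add)
  have "m - j = Suc (m' - j)" using assms jm by simp
  then have "real q ^ (j * (m - j)) = real q ^ j * real q ^ (j * (m' - j))"
    by (simp only: mult_Suc_right power_add)
  also have "\<dots> \<le> real q ^ j * gauss_binomial q m' j"
    using gauss_binomial_ge_power[OF q_gt_1, of j m'] assms jm by (intro mult_left_mono) auto
  finally show ?thesis
    using gauss_binomial_Pascal1[OF q_gt_1, of j' m'] gauss_binomial_ge_1[OF q_gt_1, of j' m'] assms jm by simp
qed

text \<open>An isolated member contributes all its subspaces of dimension \<open>k - j\<close>. That
  this is strictly more than the number of complements excludes isolated members in the case of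
  equality.\<close>

lemma card_phi_trans_set_iso:
  assumes B: "B \<in> isol" "B \<noteq> A" and j: "1 \<le> j" "j < k"
  shows "q ^ (j * (k - j)) < card (Phi B \<inter> trans_set j)"
proof -
  have BF: "B \<in> F" using B iso_subset by blast
  have "A \<inter> B = {0}" using B A by (auto simp: isolated_members_def Int_commute)
  then have "D \<inter> A = {0}" if "subspace D" "D \<subseteq> B" for D using that subspace_0[OF that(1)] by auto
  then have "Phi B \<inter> trans_set j = grassmannian B (k - j)"
    using B j by (auto simp: phi_def trans_set_def transversal_def grassmannian_def)
  then have "real (card (Phi B \<inter> trans_set j)) = gauss_binomial q k (k - j)"
    using card_grassmannian[of B "k - j"] mem BF by simp
  moreover have "\<dots> \<ge> real q ^ ((k - j) * j) + 1" using gauss_binomial_gt_power[of "k - j" k] j by simp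
  ultimately have "real (card (Phi B \<inter> trans_set j)) \<ge> real (q ^ (j * (k - j))) + 1" by (simp add: mult.commute)
  then show ?thesis by linarith
qed

lemma card_phi_trans_set:
  assumes B: "B \<in> cls j" "B \<noteq> A" and j: "1 \<le> j" "j < k"
  shows "q ^ (j * (k - j)) \<le> card (Phi B \<inter> trans_set j)"
proof (cases "B \<in> isol")
  case True
  then show ?thesis using card_phi_trans_set_iso[OF True B(2) j] by simp
next
  case False
  then have B': "B \<in> F" "idx B = j" using B by (auto simp: index_class_def)
  then have "Phi B \<inter> trans_set j = Phi B" using phi_subset_trans_set[OF B'(1) False B(2)] by auto
  then show ?thesis using card_phi_ge[OF B'(1) False B(2)] B' by simp
qed

text \<open>\<open>A\<close> is removed because no nonzero subspace of it avoids it, so it has no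
  weight here even when isolated.\<close>

lemma sum_phi_inv_ge:
  assumes j: "1 \<le> j" "j < k"
  shows "q ^ (j * (k - j)) * card (cls j - {A}) \<le> (\<Sum>B\<in>cls j - {A}. card (Phi B \<inter> trans_set j))"
    and "(\<Sum>B\<in>cls j - {A}. card (Phi B \<inter> trans_set j)) \<le> (\<Sum>D\<in>trans_set j. card (Pinv D))"
proof -
  have "(\<Sum>B\<in>cls j - {A}. q ^ (j * (k - j))) \<le> (\<Sum>B\<in>cls j - {A}. card (Phi B \<inter> trans_set j))"
    using card_phi_trans_set j by (intro sum_mono) auto
  then show "q ^ (j * (k - j)) * card (cls j - {A}) \<le> (\<Sum>B\<in>cls j - {A}. card (Phi B \<inter> trans_set j))"
    by (simp add: mult.commute)
  show "(\<Sum>B\<in>cls j - {A}. card (Phi B \<inter> trans_set j)) \<le> (\<Sum>D\<in>trans_set j. card (Pinv D))"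
    unfolding sum_card_phi_inv using index_class_subset by (intro sum_mono2) auto
qed

end

section \<open>Weighted averaging over pairs of transversal subspaces\<close>

locale covering_triple_free_family_index = covering_triple_free_family +
  fixes i :: nat
  assumes i: "1 \<le> i" "2 * i \<le> k"
begin

text \<open>Members of \<open>lo\<close> have dimension \<open>i\<close> and members of \<open>hi\<close> have dimension \<open>k - i\<close>; thus
  \<open>lo\<close> belongs to \<open>cls (k - i)\<close> and \<open>hi\<close> to \<open>cls i\<close>.\<close>
definition "Q = real q ^ (i * (k - i))"
definition "lo = trans_set (k - i)"
definition "hi = trans_set i"
text \<open>Both caps count the subspaces of a \<open>k\<close>-dimensional space through a fixed
  line, \<open>cap_lo\<close> in dimension \<open>k - i\<close> by symmetry. While
  \<open>cap_hi\<close> bounds \<open>f\<close> pointwise, \<open>cap_lo\<close> is only an average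
  bound when \<open>2 * i < k\<close>.\<close>

definition "cap_lo = gauss_binomial q (k - 1) i"
definition "cap_hi = gauss_binomial q (k - 1) (i - 1)"
definition "up_deg = real q ^ (k * (k - 2 * i)) * gauss_binomial q (dim UNIV - k - i) (k - 2 * i)"
definition "down_deg = gauss_binomial q (k - i) i"
text \<open>\<open>b_lo\<close> and \<open>b_hi\<close> are the summands of the claimed bound,
  scaled so that \<open>card lo * cap_lo = Q * b_lo\<close>, and likewise for
  \<open>hi\<close>.\<close>

definition "b_lo = real q ^ (i\<^sup>2) * gauss_binomial q (dim UNIV - k) i * cap_lo"
definition "b_hi = real q ^ ((k - i)\<^sup>2) * gauss_binomial q (dim UNIV - k) (k - i) * cap_hi"
definition "f D = real (card (Pinv D))"

lemma i_lt: "i < k" "1 \<le> k - i" "k - i < k" "i \<le> k - i"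
  using i k by auto

lemma lo_transversal: "D \<in> lo \<longleftrightarrow> transversal (k - i) D"
  and hi_transversal: "D \<in> hi \<longleftrightarrow> transversal i D"
  by (auto simp: lo_def hi_def trans_set_def)

lemma up_deg:
  assumes "D \<in> lo"
  shows "real (card {D'\<in>hi. D \<subseteq> D'}) = up_deg"
proof -
  have "k - i - i = k - 2 * i" "dim UNIV - 2 * k + (k - i) = dim UNIV - k - i" using i k by auto
  then show ?thesis
    using card_trans_set_above[of "k - i" D i] assms i i_lt
    unfolding hi_def up_deg_def lo_transversal by simp
qed

lemma down_deg:
  assumes "D' \<in> hi"
  shows "real (card {D\<in>lo. D \<subseteq> D'}) = down_deg"
  using card_trans_set_below[of i D' "k - i"] assms i i_lt
  unfolding lo_def down_deg_def hi_transversal by simp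

lemma degs_pos: "up_deg > 0" "down_deg > 0"
proof -
  have "gauss_binomial q (dim UNIV - k - i) (k - 2 * i) \<ge> 1"
    using k i by (intro gauss_binomial_ge_1[OF q_gt_1]) simp
  then show "up_deg > 0" unfolding up_deg_def using q_gt_1 by simp
  show "down_deg > 0" unfolding down_deg_def
    using gauss_binomial_ge_1[OF q_gt_1, of i "k - i"] i_lt by simp
qed

lemma up_deg_ge: "real q ^ (k * (k - 2 * i)) * down_deg \<le> up_deg"
proof -
  have "down_deg = gauss_binomial q (k - i) (k - 2 * i)"
    unfolding down_deg_def using gauss_binomial_symmetric[OF q_gt_1, of i "k - i"] i by (simp add: mult_2)
  also have "\<dots> \<le> gauss_binomial q (dim UNIV - k - i) (k - 2 * i)"
    using k by (intro gauss_binomial_mono[OF q_gt_1]) auto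
  finally show ?thesis unfolding up_deg_def by (intro mult_left_mono) auto
qed

text \<open>The margin that lets a deficit on \<open>hi\<close> outweigh an excess on
  \<open>lo\<close>.\<close>

lemma up_deg_ge': "2 * i < k \<Longrightarrow> real q ^ k * down_deg \<le> up_deg"
proof -
  assume "2 * i < k"
  then have "k * 1 \<le> k * (k - 2 * i)" by (intro mult_le_mono2) simp
  then have "real q ^ k \<le> real q ^ (k * (k - 2 * i))" using q_gt_1 by (intro power_increasing) auto
  then have "real q ^ k * down_deg \<le> real q ^ (k * (k - 2 * i)) * down_deg"
    using degs_pos by (intro mult_right_mono) auto
  with up_deg_ge show ?thesis by linarith
qed

lemma caps_ge_1: "cap_lo \<ge> 1" "cap_hi \<ge> 1"
  unfolding cap_lo_def cap_hi_def using i i_lt by (auto intro!: gauss_binomial_ge_1[OF q_gt_1])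

lemma f_hi_le: "D' \<in> hi \<Longrightarrow> f D' \<le> cap_hi"
  using card_phi_inv_le(2)[of i D'] i by (simp add: hi_transversal f_def cap_hi_def)

text \<open>Pascal's rule rewrites the cross-intersection bound as a trade of excess over
  \<open>cap_lo\<close> against deficit below \<open>cap_hi\<close>.\<close>

lemma caps_sum: "gauss_binomial q k i = cap_lo + real q ^ (k - i) * cap_hi"
proof -
  obtain i' k' where "i = Suc i'" "k = Suc k'" using i i_lt by (metis Suc_le_D One_nat_def less_imp_Suc_add)
  then show ?thesis
    unfolding cap_lo_def cap_hi_def using gauss_binomial_Pascal2[OF q_gt_1, of i' k'] i_lt by simp
qed

lemma caps_eq:
  assumes "2 * i = k"
  shows "cap_lo = cap_hi"
proof -
  have "cap_lo = gauss_binomial q (k - 1) (k - 1 - i)"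
    unfolding cap_lo_def using i_lt by (intro gauss_binomial_symmetric[OF q_gt_1]) simp
  also have "k - 1 - i = i - 1" using assms i by simp
  finally show ?thesis by (simp add: cap_hi_def)
qed

lemma f_pair_cases:
  assumes "D \<in> lo" "D' \<in> hi" "D \<subseteq> D'"
  shows "f D \<le> cap_lo \<or> f D + real q ^ (k - i) * f D' \<le> cap_lo + real q ^ (k - i) * cap_hi"
proof (cases "2 * i < k")
  case True
  then show ?thesis
    using card_phi_inv_pair[OF i(1) True] assms caps_sum
    by (auto simp: lo_transversal hi_transversal f_def cap_lo_def)
next
  case False
  then have k: "k = 2 * i" "k - i = i" using i by auto
  then have "D \<in> hi" using assms(1) unfolding lo_def hi_def by simp
  moreover have "cap_lo = cap_hi" using k by (intro caps_eq) simp
  ultimately show ?thesis using f_hi_le[of D] by simp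
qed

text \<open>An excess of \<open>f D\<close> is at most \<open>q ^ (k - i)\<close> times the deficit
  of \<open>f D'\<close>, whose weight \<open>up_deg\<close> is at least
  \<open>q ^ k * down_deg\<close>.\<close>

lemma f_pair_le:
  assumes D: "D \<in> lo" "D' \<in> hi" "D \<subseteq> D'"
  shows "down_deg * f D + up_deg * f D' \<le> down_deg * cap_lo + up_deg * cap_hi"
proof (cases "2 * i = k")
  case True
  then have "k - i = i" by simp
  then have "D \<in> hi" using D(1) unfolding lo_def hi_def by simp
  moreover have "cap_lo = cap_hi" using True by (rule caps_eq)
  ultimately show ?thesis using f_hi_le D degs_pos by (intro add_mono mult_left_mono) auto
next
  case False
  then have lt: "2 * i < k" using i by simp
  note h = f_hi_le[OF D(2)]
  show ?thesis using f_pair_cases[OF D]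
  proof
    assume "f D \<le> cap_lo"
    then show ?thesis using h degs_pos by (intro add_mono mult_left_mono) auto
  next
    assume le: "f D + real q ^ (k - i) * f D' \<le> cap_lo + real q ^ (k - i) * cap_hi"
    have "real q ^ (k - i) \<le> real q ^ k" using q_gt_1 by (intro power_increasing) auto
    then have "real q ^ (k - i) * down_deg \<le> real q ^ k * down_deg" using degs_pos by (intro mult_right_mono) auto
    then have "0 \<le> up_deg - real q ^ (k - i) * down_deg" using up_deg_ge'[OF lt] by linarith
    \<comment> \<open>The weight of \<open>f D'\<close> is split: one part goes with the pair
      inequality, the nonnegative rest with \<open>f_hi_le\<close>.\<close>
    then have "(up_deg - real q ^ (k - i) * down_deg) * f D' \<le> (up_deg - real q ^ (k - i) * down_deg) * cap_hi"
      using h by (intro mult_left_mono)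
    moreover have "down_deg * (f D + real q ^ (k - i) * f D') \<le> down_deg * (cap_lo + real q ^ (k - i) * cap_hi)"
      using le degs_pos by (intro mult_left_mono) auto
    ultimately show ?thesis by (simp add: algebra_simps)
  qed
qed

text \<open>Weighting each side by the degree of the other gives every subspace the same total
  weight \<open>up_deg * down_deg\<close>.\<close>

lemma sum_pairs:
  fixes g h :: "'b set \<Rightarrow> real"
  shows "(\<Sum>D\<in>lo. \<Sum>D' | D' \<in> hi \<and> D \<subseteq> D'. down_deg * g D + up_deg * h D') =
    up_deg * down_deg * ((\<Sum>D\<in>lo. g D) + (\<Sum>D'\<in>hi. h D'))"
proof -
  have "(\<Sum>D\<in>lo. \<Sum>D' | D' \<in> hi \<and> D \<subseteq> D'. down_deg * g D) = (\<Sum>D\<in>lo. up_deg * (down_deg * g D))"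
    using up_deg by (intro sum.cong refl) simp
  moreover have "(\<Sum>D\<in>lo. \<Sum>D' | D' \<in> hi \<and> D \<subseteq> D'. up_deg * h D') =
      (\<Sum>D'\<in>hi. \<Sum>D | D \<in> lo \<and> D \<subseteq> D'. up_deg * h D')"
    by (rule sum.swap_restrict) auto
  moreover have "\<dots> = (\<Sum>D'\<in>hi. down_deg * (up_deg * h D'))"
    using down_deg by (intro sum.cong refl) simp
  ultimately show ?thesis by (simp add: sum.distrib sum_distrib_left distrib_left mult_ac)
qed

lemma caps_total: "real (card lo) * cap_lo + real (card hi) * cap_hi = Q * (b_lo + b_hi)"
  and card_lo: "real (card lo) * cap_lo = Q * b_lo"
  and card_hi: "real (card hi) * cap_hi = Q * b_hi"
proof -
  obtain d where d: "k = i + d" using i_lt less_imp_add_positive by blast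
  \<comment> \<open>Splits off the factor \<open>Q\<close>, the lower bound for the weight of a
    member.\<close>
  have "k * i = i * (k - i) + i\<^sup>2" "k * (k - i) = i * (k - i) + (k - i)\<^sup>2"
    unfolding d by (simp_all add: algebra_simps power2_eq_square)
  then have e: "real q ^ (k * i) = Q * real q ^ (i\<^sup>2)" "real q ^ (k * (k - i)) = Q * real q ^ ((k - i)\<^sup>2)"
    by (simp_all add: Q_def power_add)
  show lo: "real (card lo) * cap_lo = Q * b_lo"
    using card_trans_set[of "k - i"] i_lt e by (simp add: lo_def b_lo_def)
  show hi: "real (card hi) * cap_hi = Q * b_hi"
    using card_trans_set[of i] i i_lt e by (simp add: hi_def b_hi_def)
  show "real (card lo) * cap_lo + real (card hi) * cap_hi = Q * (b_lo + b_hi)"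
    unfolding lo hi by (simp add: distrib_left)
qed

lemma sum_f_le: "(\<Sum>D\<in>lo. f D) + (\<Sum>D\<in>hi. f D) \<le> Q * (b_lo + b_hi)"
proof -
  have "up_deg * down_deg * ((\<Sum>D\<in>lo. f D) + (\<Sum>D\<in>hi. f D)) \<le>
      up_deg * down_deg * ((\<Sum>D\<in>lo. cap_lo) + (\<Sum>D\<in>hi. cap_hi))"
    unfolding sum_pairs[symmetric] using f_pair_le by (intro sum_mono) auto
  then show ?thesis using degs_pos caps_total by (simp add: mult_le_cancel_left_pos)
qed

text \<open>Equality of the sums makes \<open>f_pair_le\<close> tight for every pair;
  \<open>f D'\<close> cannot exceed its cap, so \<open>f D\<close> cannot fall below its
  own.\<close>

lemma sum_f_eq_imp:
  assumes eq: "(\<Sum>D\<in>lo. f D) + (\<Sum>D\<in>hi. f D) = Q * (b_lo + b_hi)" and D: "D \<in> lo"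
  shows "cap_lo \<le> f D"
proof -
  obtain D' where D': "D' \<in> hi" "D \<subseteq> D'"
  proof -
    have "{D'\<in>hi. D \<subseteq> D'} \<noteq> {}"
    proof
      assume "{D'\<in>hi. D \<subseteq> D'} = {}"
      then show False using up_deg[OF D] degs_pos by (simp only: card.empty)
    qed
    then show ?thesis using that by blast
  qed
  let ?s = "\<lambda>D D'. (down_deg * cap_lo + up_deg * cap_hi) - (down_deg * f D + up_deg * f D')"
  have "(\<Sum>D\<in>lo. \<Sum>D' | D' \<in> hi \<and> D \<subseteq> D'. ?s D D') = 0"
    unfolding sum_subtractf sum_pairs using eq caps_total by (simp flip: distrib_left)
  then have "(\<Sum>D' | D' \<in> hi \<and> D \<subseteq> D'. ?s D D') = 0"
    using D f_pair_le by (subst (asm) sum_nonneg_eq_0_iff) (auto intro!: sum_nonneg)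
  then have "?s D D' = 0"
    using D D' f_pair_le by (subst (asm) sum_nonneg_eq_0_iff) auto
  moreover have "up_deg * f D' \<le> up_deg * cap_hi"
    using f_hi_le[OF D'(1)] degs_pos by (intro mult_left_mono) auto
  ultimately have "down_deg * cap_lo \<le> down_deg * f D" by linarith
  then show ?thesis using degs_pos by (simp add: mult_le_cancel_left_pos)
qed

end

section \<open>The two cases: \<open>A\<close> isolated or not\<close>

context covering_triple_free_family begin

text \<open>When \<open>A\<close> is isolated, the index of every other member is a minimum over all of \<open>F\<close>, so
  \<open>Phi Z\<close> contains every \<open>D \<subseteq> Z\<close> that lies in some \<open>Phi B\<close> for a \<open>B\<close> of the same index.\<close>
lemma phi_inv_empty:
  assumes Aiso: "A \<in> isol" and D: "transversal j D" and Z: "Z \<in> cls j" "Z \<noteq> A" "D \<subseteq> Z" "D \<notin> Phi Z"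
  shows "Pinv D = {}"
proof (rule ccontr)
  assume "Pinv D \<noteq> {}"
  then obtain B where B: "B \<in> Pinv D" by blast
  have sD: "subspace D" "dim D = k - j" using D by (auto simp: transversal_def)
  have Ziso: "Z \<notin> isol" using Z sD by (auto simp: phi_def)
  then have ZF: "Z \<in> F" "idx Z = j" using Z by (auto simp: index_class_def)
  have BZ: "Z \<noteq> B" using B Z by (auto simp: phi_inv_def)
  have Biso: "B \<notin> isol" using phi_inv_iso[OF D B _ ZF(1) Z(3)] BZ by blast
  obtain C where C: "C \<in> F" "dim (B \<inter> C) = j" "D \<inter> C = {0}" using phi_invE[OF D B Biso] by metis
  have BF: "B \<in> F" using phi_invD[OF D B] by blast
  have "k - j < dim (B \<inter> Z)" using phi_inv_Int_dim[OF D B Biso ZF(1) Z(3) BZ] .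
  then have "B \<inter> Z \<inter> C \<noteq> {0}" using C BF ZF by (intro Int_Int_nontrivial) auto
  then have "Z \<inter> C \<noteq> {0}" by (rule nontrivial_superset[OF BF ZF(1) C(1)]) auto
  \<comment> \<open>As \<open>A\<close> is isolated, the index of \<open>Z\<close> is a minimum, to
    which the nontrivial \<open>Z \<inter> C\<close> can be compared.\<close>
  moreover have AZ: "A \<inter> Z = {0}" using Aiso ZF Z by (auto simp: isolated_members_def)
  ultimately have "j \<le> dim (Z \<inter> C)" using idx_min[OF AZ C(1)] ZF by simp
  moreover have "dim (Z \<inter> C) \<le> j" using dim_Int_complement_le[OF D ZF(1) Z(3) C(1,3)] .
  ultimately have "C \<in> partners Z" using AZ C ZF by (simp add: meet_partners_def)
  then have "D \<in> Phi Z" using Ziso sD ZF Z C by (auto simp: phi_def dim_subspace_def)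
  with Z show False by simp
qed

definition "zeros j = {D\<in>trans_set j. Pinv D = {}}"

lemma card_hyperplanes_above:
  assumes "subspace S" "dim S < dim UNIV"
  shows "real (card {T\<in>grassmannian UNIV (dim UNIV - 1). S \<subseteq> T}) = qnum (dim UNIV - dim S)"
  using card_subspaces_between[of UNIV S "dim UNIV - 1"] assms
    gauss_binomial_symmetric[OF q_gt_1, of 1 "dim UNIV - dim S"] by simp

text \<open>Otherwise each of the \<open>qnum (dim UNIV - k)\<close> hyperplanes through
  \<open>A\<close> contains some \<open>D\<close> from \<open>zeros j\<close>. Each \<open>D\<close>
  accounts for only \<open>qnum (dim UNIV - 2 * k + j)\<close> of them, which is too few for
  \<open>q ^ (k - j)\<close> subspaces.\<close>

lemma exists_hyperplane_avoiding_zeros: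
  assumes j: "1 \<le> j" "j < k" and z: "card (zeros j) \<le> q ^ (k - j)"
  obtains T where "T \<in> grassmannian UNIV (dim UNIV - 1)" "A \<subseteq> T" "\<And>D. D \<in> zeros j \<Longrightarrow> \<not> D \<subseteq> T"
proof (rule ccontr)
  assume no: "\<not> thesis"
  let ?H = "{T\<in>grassmannian UNIV (dim UNIV - 1). A \<subseteq> T}"
  have "real (card ?H) = (\<Sum>T\<in>?H. 1)" by simp
  also have "\<dots> \<le> (\<Sum>T\<in>?H. real (card {D\<in>zeros j. D \<subseteq> T}))"
  proof (rule sum_mono)
    fix T assume "T \<in> ?H"
    then have "{D\<in>zeros j. D \<subseteq> T} \<noteq> {}" using that no by blast
    then have "card {D\<in>zeros j. D \<subseteq> T} > 0" by (simp add: card_gt_0_iff)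
    then show "1 \<le> real (card {D\<in>zeros j. D \<subseteq> T})" by simp
  qed
  also have "\<dots> = real (\<Sum>D\<in>zeros j. card {T\<in>?H. D \<subseteq> T})"
    using double_count[of ?H "zeros j" "\<lambda>T D. D \<subseteq> T"] by (simp flip: of_nat_sum)
  also have "\<dots> = (\<Sum>D\<in>zeros j. qnum (dim UNIV - 2 * k + j))"
    unfolding of_nat_sum
  proof (rule sum.cong[OF refl])
    fix D assume "D \<in> zeros j"
    then have D: "subspace D" "dim D = k - j" "A \<inter> D = {0}"
      by (auto simp: zeros_def trans_set_def transversal_def)
    have "{T\<in>?H. D \<subseteq> T} = {T\<in>grassmannian UNIV (dim UNIV - 1). sumset A D \<subseteq> T}"
    proof (rule Collect_cong, rule iffI; elim conjE)
      fix T assume T: "T \<in> ?H" "D \<subseteq> T"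
      then have "sumset A D \<subseteq> T" by (intro sumset_subset) (auto simp: grassmannian_def)
      with T show "T \<in> grassmannian UNIV (dim UNIV - 1) \<and> sumset A D \<subseteq> T" by blast
    next
      fix T assume T: "T \<in> grassmannian UNIV (dim UNIV - 1)" "sumset A D \<subseteq> T"
      then show "T \<in> ?H \<and> D \<subseteq> T"
        using sumset_superset1[OF D(1), of A] sumset_superset2[OF mem(1)[OF A], of D] by blast
    qed
    moreover have "subspace (sumset A D)" using mem(1)[OF A] D by (intro subspace_sums)
    moreover have "dim (sumset A D) = 2 * k - j"
      using dim_sums_Int[OF mem(1)[OF A] D(1)] D mem(2)[OF A] j by simp
    moreover have "dim UNIV - (2 * k - j) = dim UNIV - 2 * k + j" "2 * k - j < dim UNIV" using j k by auto
    ultimately show "real (card {T\<in>?H. D \<subseteq> T}) = qnum (dim UNIV - 2 * k + j)"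
      using card_hyperplanes_above[of "sumset A D"] by simp
  qed
  also have "\<dots> \<le> real q ^ (k - j) * qnum (dim UNIV - 2 * k + j)"
    using z qnum_nonneg[of "dim UNIV - 2 * k + j"] by (simp add: mult_right_mono flip: of_nat_power)
  also have "\<dots> < qnum (k - j) + real q ^ (k - j) * qnum (dim UNIV - 2 * k + j)"
    using qnum_pos[of "k - j"] j by simp
  also have "\<dots> = qnum (dim UNIV - k)"
  proof -
    have "k - j + (dim UNIV - 2 * k + j) = dim UNIV - k" using k j by simp
    then show ?thesis using qnum_add[of "k - j" "dim UNIV - 2 * k + j"] by simp
  qed
  also have "\<dots> = real (card ?H)"
    using card_hyperplanes_above[OF mem(1)[OF A]] mem(2)[OF A] k by simp
  finally show False by simp
qed

text \<open>Inside the hyperplane \<open>T\<close> no \<open>Pinv\<close> is empty, so by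
  \<open>phi_inv_empty\<close> every subspace of \<open>B \<inter> T\<close> of dimension
  \<open>k - j\<close> lies in \<open>Phi B\<close>. Since
  \<open>dim (B \<inter> T) \<ge> k - 1\<close>, the weight of \<open>B\<close> is at least the cap
  itself.\<close>

lemma card_index_class_hyperplane:
  assumes Aiso: "A \<in> isol" and j: "1 \<le> j" "j < k" and z: "card (zeros j) \<le> q ^ (k - j)"
  obtains \<T> where "\<T> \<subseteq> trans_set j"
    "real (card \<T>) = real q ^ (k * (k - j)) * gauss_binomial q (dim UNIV - k - 1) (k - j)"
    "real (card (cls j - {A})) * gauss_binomial q (k - 1) (j - 1) \<le> (\<Sum>D\<in>\<T>. real (card (Pinv D)))"
proof -
  obtain T where T: "T \<in> grassmannian UNIV (dim UNIV - 1)" "A \<subseteq> T" "\<And>D. D \<in> zeros j \<Longrightarrow> \<not> D \<subseteq> T"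
    using exists_hyperplane_avoiding_zeros[OF j z] by blast
  then have T': "subspace T" "dim T = dim UNIV - 1" by (auto simp: grassmannian_def)
  let ?T = "{D\<in>trans_set j. D \<subseteq> T}"
  have "?T = subspaces_avoiding T {0} A (k - j)"
    unfolding trans_set_eq[OF j] by (auto simp: subspaces_avoiding_def)
  then have "real (card ?T) = real q ^ (k * (k - j)) * gauss_binomial q (dim UNIV - k - 1) (k - j)"
    using card_subspaces_avoiding[of T "{0}" A "k - j"] T' T(2) mem[OF A] subspace_0[OF mem(1)[OF A]]
      subspace_0[OF T'(1)] j k by (simp add: subspace_single_0)
  moreover have "real (card (cls j - {A})) * gauss_binomial q (k - 1) (j - 1) \<le> (\<Sum>D\<in>?T. real (card (Pinv D)))"
  proof -
    have "real (card (cls j - {A})) * gauss_binomial q (k - 1) (j - 1) =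
        (\<Sum>B\<in>cls j - {A}. gauss_binomial q (k - 1) (j - 1))" by simp
    also have "\<dots> \<le> (\<Sum>B\<in>cls j - {A}. real (card {D\<in>?T. D \<in> Phi B}))"
    proof (rule sum_mono)
      fix B assume B: "B \<in> cls j - {A}"
      then have BF: "B \<in> F" using index_class_subset by blast
      then have AB: "A \<inter> B = {0}" using Aiso B by (auto simp: isolated_members_def)
      have sBT: "subspace (B \<inter> T)" using mem(1)[OF BF] T' by (intro subspace_inter)
      have "dim B + dim T \<le> dim UNIV + dim (B \<inter> T)" using mem(1)[OF BF] T' by (intro dim_Int_ge) auto
      then have "k - 1 \<le> dim (B \<inter> T)" using mem(2)[OF BF] T' k by simp
      then have "gauss_binomial q (k - 1) (k - j) \<le> gauss_binomial q (dim (B \<inter> T)) (k - j)"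
        using j by (intro gauss_binomial_mono[OF q_gt_1]) auto
      also have "\<dots> = real (card (grassmannian (B \<inter> T) (k - j)))"
        using card_grassmannian[OF sBT] j \<open>k - 1 \<le> dim (B \<inter> T)\<close> by simp
      also have "\<dots> \<le> real (card {D\<in>?T. D \<in> Phi B})"
      proof -
        have "grassmannian (B \<inter> T) (k - j) \<subseteq> {D\<in>?T. D \<in> Phi B}"
        proof
          fix D assume D: "D \<in> grassmannian (B \<inter> T) (k - j)"
          then have D': "subspace D" "dim D = k - j" "D \<subseteq> B" "D \<subseteq> T" by (auto simp: grassmannian_def)
          then have "D \<inter> A = {0}" using AB subspace_0[OF D'(1)] by auto
          then have tr: "transversal j D" using D' j by (simp add: transversal_def)
          then have "Pinv D \<noteq> {}" using T(3)[of D] D' by (auto simp: zeros_def trans_set_def)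
          then have "D \<in> Phi B" using phi_inv_empty[OF Aiso tr, of B] B D' by blast
          with tr D' show "D \<in> {D\<in>?T. D \<in> Phi B}" by (simp add: trans_set_def)
        qed
        then show ?thesis by (simp add: card_mono)
      qed
      finally show "gauss_binomial q (k - 1) (j - 1) \<le> real (card {D\<in>?T. D \<in> Phi B})"
        using gauss_binomial_symmetric[OF q_gt_1, of "j - 1" "k - 1"] j by simp
    qed
    also have "\<dots> \<le> (\<Sum>B\<in>F. real (card {D\<in>?T. D \<in> Phi B}))"
      using index_class_subset by (intro sum_mono2) auto
    also have "\<dots> = (\<Sum>D\<in>?T. real (card (Pinv D)))"
      using double_count[of F ?T "\<lambda>B D. D \<in> Phi B"] by (simp add: phi_inv_def flip: of_nat_sum)
    finally show ?thesis .
  qed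
  ultimately show ?thesis by (intro that[of ?T]) auto
qed

end

section \<open>The bound for a non-isolated \<open>A\<close>\<close>

context covering_triple_free_family_index begin

lemma Q_card_le:
  "Q * real (card (cls i - {A})) \<le> (\<Sum>D\<in>hi. f D)"
  "Q * real (card (cls (k - i) - {A})) \<le> (\<Sum>D\<in>lo. f D)"
proof -
  have "real (q ^ (i * (k - i)) * card (cls i - {A})) \<le> real (\<Sum>D\<in>hi. card (Pinv D))"
    using sum_phi_inv_ge[of i] i i_lt unfolding hi_def by (intro of_nat_mono) (rule order_trans; simp)
  then show "Q * real (card (cls i - {A})) \<le> (\<Sum>D\<in>hi. f D)" by (simp add: Q_def f_def)
  have "real (q ^ ((k - i) * (k - (k - i))) * card (cls (k - i) - {A})) \<le> real (\<Sum>D\<in>lo. card (Pinv D))"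
    using sum_phi_inv_ge[of "k - i"] i i_lt unfolding lo_def by (intro of_nat_mono) (rule order_trans; simp)
  then show "Q * real (card (cls (k - i) - {A})) \<le> (\<Sum>D\<in>lo. f D)"
    using i_lt by (simp add: Q_def f_def mult.commute)
qed

lemma Q_pos: "Q > 0"
  using q_gt_1 by (simp add: Q_def)

text \<open>If \<open>A\<close> is not isolated it has index \<open>k\<close> and is thus not counted.\<close>
lemma nonisolated_bound:
  assumes Aiso: "A \<notin> isol"
  shows "real (card (cls i)) + real (card (cls (k - i))) \<le> b_hi + b_lo"
    and "real (card (cls i)) + real (card (cls (k - i))) = b_hi + b_lo \<Longrightarrow>
      (\<forall>D\<in>lo. cap_lo \<le> f D) \<and> isol = {} \<and> (\<forall>B\<in>cls i \<union> cls (k - i). card (Phi B) = q ^ (i * (k - i)))"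
proof -
  have nA: "A \<notin> cls i" "A \<notin> cls (k - i)" using Aiso idx_A i i_lt by (auto simp: index_class_def)
  then have e: "cls i - {A} = cls i" "cls (k - i) - {A} = cls (k - i)" by auto
  have "Q * (real (card (cls i)) + real (card (cls (k - i)))) \<le> (\<Sum>D\<in>lo. f D) + (\<Sum>D\<in>hi. f D)"
    using Q_card_le unfolding e by (simp add: distrib_left)
  also have "\<dots> \<le> Q * (b_hi + b_lo)" using sum_f_le by (simp add: add.commute)
  finally show "real (card (cls i)) + real (card (cls (k - i))) \<le> b_hi + b_lo"
    using Q_pos by (simp add: mult_le_cancel_left_pos)
  assume eq: "real (card (cls i)) + real (card (cls (k - i))) = b_hi + b_lo"
  \<comment> \<open>The two lower bounds add up to the upper bound, so each of them is
    attained.\<close>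
  have sums: "(\<Sum>D\<in>hi. f D) = Q * real (card (cls i))" "(\<Sum>D\<in>lo. f D) = Q * real (card (cls (k - i)))"
    using Q_card_le sum_f_le unfolding e eq[symmetric, unfolded add.commute[of b_hi]]
    by (auto simp: distrib_left)
  then have lower: "\<forall>D\<in>lo. cap_lo \<le> f D"
    using sum_f_eq_imp eq by (simp add: add.commute flip: distrib_left)
  have weights: "card (Phi B \<inter> trans_set j) = q ^ (j * (k - j))"
    if B: "B \<in> cls j" and j: "j = i \<or> j = k - i" for B j
  proof -
    have j': "1 \<le> j" "j < k" "A \<notin> cls j" using j i i_lt nA by auto
    have "(\<Sum>D\<in>trans_set j. f D) = Q * real (card (cls j))"
      using j sums by (auto simp: hi_def lo_def)
    moreover have "real q ^ (j * (k - j)) = Q" using j i_lt by (auto simp: Q_def mult.commute)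
    ultimately have "real (\<Sum>D\<in>trans_set j. card (Pinv D)) = real (q ^ (j * (k - j)) * card (cls j))"
      by (simp add: f_def)
    then have "(\<Sum>D\<in>trans_set j. card (Pinv D)) = q ^ (j * (k - j)) * card (cls j)"
      by (simp only: of_nat_eq_iff)
    then have "(\<Sum>B\<in>cls j. card (Phi B \<inter> trans_set j)) \<le> (\<Sum>B\<in>cls j. q ^ (j * (k - j)))"
      using sum_phi_inv_ge(2)[of j] j' by (simp add: mult.commute)
    moreover have "q ^ (j * (k - j)) \<le> card (Phi B \<inter> trans_set j)" if "B \<in> cls j" for B
      using card_phi_trans_set[OF that] that j' by blast
    \<comment> \<open>Termwise lower bounds with equal totals are equalities.\<close>
    ultimately have "\<forall>B\<in>cls j. card (Phi B \<inter> trans_set j) = q ^ (j * (k - j))"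
      using sum_mono_inv[of "\<lambda>_. q ^ (j * (k - j))" "cls j" "\<lambda>B. card (Phi B \<inter> trans_set j)"]
        sum_mono[of "cls j" "\<lambda>_. q ^ (j * (k - j))" "\<lambda>B. card (Phi B \<inter> trans_set j)"]
      by (metis finite_space_sets le_antisym)
    with B show ?thesis by blast
  qed
  \<comment> \<open>An isolated member would belong to \<open>cls i\<close> with strictly larger
    weight.\<close>
  have noiso: "isol = {}"
  proof (rule ccontr)
    assume "isol \<noteq> {}"
    then obtain B where B: "B \<in> isol" by blast
    then have "B \<in> cls i" by (simp add: index_class_def)
    then show False
      using weights[of B i] card_phi_trans_set_iso[of B i] B Aiso i i_lt by auto
  qed
  have "card (Phi B) = q ^ (i * (k - i))" if B: "B \<in> cls i \<union> cls (k - i)" for B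
  proof -
    obtain j where j: "j = i \<or> j = k - i" "B \<in> cls j" using B by blast
    then have B': "B \<in> F" "B \<notin> isol" "idx B = j" "B \<noteq> A" using noiso nA by (auto simp: index_class_def)
    then have "Phi B \<inter> trans_set j = Phi B" using phi_subset_trans_set[of B] by auto
    moreover have "j * (k - j) = i * (k - i)" using j i_lt by (auto simp: mult.commute)
    ultimately show ?thesis using weights[OF j(2,1)] by simp
  qed
  with lower noiso show "(\<forall>D\<in>lo. cap_lo \<le> f D) \<and> isol = {} \<and>
      (\<forall>B\<in>cls i \<union> cls (k - i). card (Phi B) = q ^ (i * (k - i)))" by blast
qed

end

section \<open>The bound for an isolated \<open>A\<close>\<close>

context covering_triple_free_family_index begin

lemma powers_Q: "real q ^ (k * i) = real q ^ (i\<^sup>2) * Q" "real q ^ (k * (k - i)) = real q ^ ((k - i)\<^sup>2) * Q"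
proof -
  obtain d where d: "k = i + d" using i_lt less_imp_add_positive by blast
  have "k * i = i\<^sup>2 + i * (k - i)" "k * (k - i) = (k - i)\<^sup>2 + i * (k - i)"
    unfolding d by (simp_all add: algebra_simps power2_eq_square)
  then show "real q ^ (k * i) = real q ^ (i\<^sup>2) * Q" "real q ^ (k * (k - i)) = real q ^ ((k - i)\<^sup>2) * Q"
    by (simp_all add: Q_def power_add)
qed

lemma Q_le_hi: "Q \<le> real q ^ (k - i) * cap_hi"
proof -
  have "i * (k - i) = (k - i) + (i - 1) * (k - 1 - (i - 1))"
    using i i_lt by (cases i) auto
  then have "Q = real q ^ (k - i) * real q ^ ((i - 1) * (k - 1 - (i - 1)))"
    by (simp add: Q_def flip: power_add)
  also have "\<dots> \<le> real q ^ (k - i) * cap_hi"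
    unfolding cap_hi_def using i i_lt by (intro mult_left_mono gauss_binomial_ge_power[OF q_gt_1]) auto
  finally show ?thesis .
qed

lemma cap_lo_gt:
  assumes "2 * i < k"
  shows "Q + real q ^ i \<le> real q ^ i * cap_lo"
proof -
  have "k - i = Suc (k - 1 - i)" using i_lt by simp
  then have "Q = real q ^ i * real q ^ (i * (k - 1 - i))"
    by (simp only: Q_def mult_Suc_right power_add)
  then have "Q + real q ^ i = real q ^ i * (real q ^ (i * (k - 1 - i)) + 1)"
    by (simp add: distrib_left)
  also have "\<dots> \<le> real q ^ i * cap_lo"
    unfolding cap_lo_def using assms i by (intro mult_left_mono gauss_binomial_gt_power) auto
  finally show ?thesis .
qed

text \<open>In Pascal's rule for \<open>dim UNIV - k\<close> the term with factor
  \<open>q ^ j\<close> already dominates the count inside a hyperplane; the other term is the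
  surplus.\<close>

lemma b_ge_hyperplane:
  assumes "1 \<le> j" "j \<le> k" "Q \<le> real q ^ j * c" "c \<ge> 0"
  shows "real q ^ (j\<^sup>2) * Q * gauss_binomial q (dim UNIV - k - 1) j + real q ^ (j\<^sup>2) * c
    \<le> real q ^ (j\<^sup>2) * gauss_binomial q (dim UNIV - k) j * c"
proof -
  obtain j' where j': "j = Suc j'" using assms by (cases j) auto
  obtain m where m: "dim UNIV - k = Suc m" "j' \<le> m" using k assms j' by (cases "dim UNIV - k") auto
  have P: "gauss_binomial q (dim UNIV - k) j = real q ^ j * gauss_binomial q m j + gauss_binomial q m j'"
    using gauss_binomial_Pascal1[OF q_gt_1 m(2)] m j' by simp
  have "Q * gauss_binomial q m j \<le> real q ^ j * c * gauss_binomial q m j"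
    using assms q_gt_1 by (intro mult_right_mono gauss_binomial_nonneg) auto
  moreover have "1 * c \<le> gauss_binomial q m j' * c"
    using assms gauss_binomial_ge_1[OF q_gt_1 m(2)] by (intro mult_right_mono) auto
  ultimately have "Q * gauss_binomial q m j + c \<le> gauss_binomial q (dim UNIV - k) j * c"
    unfolding P by (simp add: algebra_simps)
  then have "real q ^ (j\<^sup>2) * (Q * gauss_binomial q m j + c) \<le> real q ^ (j\<^sup>2) * (gauss_binomial q (dim UNIV - k) j * c)"
    by (intro mult_left_mono) auto
  then show ?thesis using m by (simp add: algebra_simps)
qed

text \<open>The slack \<open>1\<close> makes room for \<open>A\<close> itself. A class this large
  would leave few empty \<open>Pinv\<close>, and the hyperplane count would then push it at least
  \<open>2\<close> below \<open>b_hi\<close>.\<close>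

lemma card_hi_less:
  assumes Aiso: "A \<in> isol"
  shows "real (card (cls i - {A})) < b_hi - 1"
proof (rule ccontr)
  let ?c = "real (card (cls i - {A}))" and ?z = "real (card (zeros i))"
  assume "\<not> ?c < b_hi - 1"
  then have c: "b_hi - 1 \<le> ?c" by simp
  have "(\<Sum>D\<in>hi. f D) \<le> (\<Sum>D\<in>hi. cap_hi - (if D \<in> zeros i then cap_hi else 0))"
    using f_hi_le by (intro sum_mono) (auto simp: zeros_def f_def)
  also have "\<dots> = Q * b_hi - ?z * cap_hi"
  proof -
    have "hi \<inter> zeros i = zeros i" by (auto simp: zeros_def hi_def)
    then show ?thesis using card_hi by (simp add: sum_subtractf flip: sum.inter_restrict)
  qed
  finally have "Q * ?c \<le> Q * b_hi - ?z * cap_hi" using Q_card_le(1) by linarith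
  moreover have "Q * (b_hi - 1) \<le> Q * ?c" using c Q_pos by (intro mult_left_mono) auto
  \<comment> \<open>Each empty \<open>Pinv\<close> wastes \<open>cap_hi\<close>, and the assumed
    size tolerates a total waste of only \<open>Q\<close>.\<close>
  ultimately have "?z * cap_hi \<le> Q" by (simp add: right_diff_distrib)
  also have "\<dots> \<le> real q ^ (k - i) * cap_hi" by (rule Q_le_hi)
  finally have "?z \<le> real q ^ (k - i)" using caps_ge_1 by (simp add: mult_le_cancel_right)
  then have "card (zeros i) \<le> q ^ (k - i)" by (metis of_nat_le_iff of_nat_power)
  from card_index_class_hyperplane[OF Aiso i(1) i_lt(1) this]
  obtain \<T> where T: "\<T> \<subseteq> trans_set i"
    "real (card \<T>) = real q ^ (k * (k - i)) * gauss_binomial q (dim UNIV - k - 1) (k - i)"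
    "?c * cap_hi \<le> (\<Sum>D\<in>\<T>. f D)"
    unfolding cap_hi_def f_def by blast
  have "(\<Sum>D\<in>\<T>. f D) \<le> (\<Sum>D\<in>\<T>. cap_hi)"
    using T(1) f_hi_le by (intro sum_mono) (auto simp: hi_def)
  with T(3) have "?c * cap_hi \<le> real (card \<T>) * cap_hi" by simp
  then have "?c \<le> real (card \<T>)" using caps_ge_1 by (simp add: mult_le_cancel_right)
  moreover have "real (card \<T>) + real q ^ ((k - i)\<^sup>2) * cap_hi \<le> b_hi"
    unfolding T(2) powers_Q(2) b_hi_def using b_ge_hyperplane[of "k - i" cap_hi] i_lt Q_le_hi caps_ge_1 by simp
  moreover have "real q ^ ((k - i)\<^sup>2) * cap_hi \<ge> 2"
  proof -
    have "real q ^ 1 \<le> real q ^ ((k - i)\<^sup>2)" using q_gt_1 i_lt by (intro power_increasing) auto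
    moreover have "2 \<le> real q" using q_gt_1 by simp
    ultimately have "2 \<le> real q ^ ((k - i)\<^sup>2)" unfolding power_one_right by linarith
    then have "2 * 1 \<le> real q ^ ((k - i)\<^sup>2) * cap_hi" using caps_ge_1 by (intro mult_mono) auto
    then show ?thesis by simp
  qed
  ultimately show False using c by linarith
qed

text \<open>For \<open>2 * i < k\<close> the values \<open>f D\<close> with \<open>D\<close> of dimension \<open>i\<close> may exceed \<open>cap_lo\<close>; the excess
  is paid for at least \<open>q ^ i\<close> times by the deficit on the subspaces of dimension \<open>k - i\<close>.\<close>
lemma excess_le_deficit:
  assumes lt: "2 * i < k"
  shows "real q ^ i * (\<Sum>D\<in>lo. max 0 (f D - cap_lo)) \<le> (\<Sum>D\<in>hi. cap_hi - f D)"
proof -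
  let ?x = "\<lambda>D. max 0 (f D - cap_lo)"
  have "down_deg * (real q ^ i * ?x D) + up_deg * (f D' - cap_hi) \<le> 0"
    if D: "D \<in> lo" "D' \<in> hi" "D \<subseteq> D'" for D D'
  proof -
    have y: "0 \<le> cap_hi - f D'" using f_hi_le[OF D(2)] by simp
    then have y': "0 \<le> real q ^ (k - i) * (cap_hi - f D')" by simp
    \<comment> \<open>One alternative of \<open>f_pair_cases\<close> has no excess; the other bounds
      it by the deficit.\<close>
    have "?x D \<le> real q ^ (k - i) * (cap_hi - f D')"
      using f_pair_cases[OF D] y' by (auto simp: max_def algebra_simps)
    then have "real q ^ i * ?x D \<le> real q ^ i * (real q ^ (k - i) * (cap_hi - f D'))"
      by (intro mult_left_mono) auto
    \<comment> \<open>The extra factor \<open>q ^ i\<close> uses up exactly the margin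
      \<open>q ^ k\<close> of \<open>up_deg_ge'\<close>.\<close>
    also have "\<dots> = real q ^ k * (cap_hi - f D')" using i_lt by (simp flip: power_add mult.assoc)
    finally have "down_deg * (real q ^ i * ?x D) \<le> down_deg * (real q ^ k * (cap_hi - f D'))"
      using degs_pos by (intro mult_left_mono) auto
    also have "\<dots> = (real q ^ k * down_deg) * (cap_hi - f D')" by simp
    also have "\<dots> \<le> up_deg * (cap_hi - f D')" using up_deg_ge'[OF lt] y by (intro mult_right_mono)
    finally show ?thesis by (simp add: algebra_simps)
  qed
  then have "(\<Sum>D\<in>lo. \<Sum>D' | D' \<in> hi \<and> D \<subseteq> D'. down_deg * (real q ^ i * ?x D) + up_deg * (f D' - cap_hi)) \<le> 0"
    by (intro sum_nonpos) auto
  then have "up_deg * down_deg * ((\<Sum>D\<in>lo. real q ^ i * ?x D) + (\<Sum>D'\<in>hi. f D' - cap_hi)) \<le> 0"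
    by (simp only: sum_pairs)
  then have "(\<Sum>D\<in>lo. real q ^ i * ?x D) + (\<Sum>D'\<in>hi. f D' - cap_hi) \<le> 0"
    using degs_pos by (simp add: mult_le_0_iff zero_less_mult_iff not_less)
  then show ?thesis by (simp add: sum_subtractf flip: sum_distrib_left)
qed

text \<open>The case not settled by \<open>card_hi_less\<close>. Being nearly full, both classes
  together force a small excess \<open>E\<close> and a small shortfall \<open>Z\<close> on
  \<open>lo\<close>, hence few empty \<open>Pinv\<close>; the hyperplane count with error
  \<open>E\<close> then contradicts \<open>lo_big\<close>. The summand \<open>2\<close> accounts for
  \<open>A\<close> in both classes.\<close>

lemma isolated_bound_lt:
  assumes Aiso: "A \<in> isol" and lt: "2 * i < k"
    and lo_big: "b_lo - 1 < real (card (cls (k - i) - {A}))"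
  shows "real (card (cls i - {A})) + real (card (cls (k - i) - {A})) + 2 < b_hi + b_lo"
proof (rule ccontr)
  let ?c = "real (card (cls i - {A}))" and ?d = "real (card (cls (k - i) - {A}))"
  let ?z = "real (card (zeros (k - i)))"
  define u where "u = real q ^ i"
  define E where "E = (\<Sum>D\<in>lo. max 0 (f D - cap_lo))"
  define Z where "Z = (\<Sum>D\<in>lo. max 0 (cap_lo - f D))"
  define Y where "Y = (\<Sum>D\<in>hi. cap_hi - f D)"
  assume "\<not> ?c + ?d + 2 < b_hi + b_lo"
  then have total: "b_hi + b_lo - 2 \<le> ?c + ?d" by simp
  have u2: "u \<ge> 2"
  proof -
    have "real q ^ 1 \<le> real q ^ i" using q_gt_1 i by (intro power_increasing) auto
    moreover have "2 \<le> real q" using q_gt_1 by simp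
    ultimately have "2 \<le> real q ^ i" unfolding power_one_right by linarith
    then show ?thesis by (simp add: u_def)
  qed
  have E0: "E \<ge> 0" and Z0: "Z \<ge> 0" unfolding E_def Z_def by (auto intro: sum_nonneg)
  have EY: "u * E \<le> Y" using excess_le_deficit[OF lt] by (simp add: E_def Y_def u_def)
  have "(\<Sum>D\<in>lo. f D) = (\<Sum>D\<in>lo. cap_lo + max 0 (f D - cap_lo) - max 0 (cap_lo - f D))"
    by (intro sum.cong) auto
  then have lo_sum: "(\<Sum>D\<in>lo. f D) = Q * b_lo + E - Z"
    using card_lo by (simp add: sum.distrib sum_subtractf E_def Z_def)
  have hi_sum: "(\<Sum>D\<in>hi. f D) = Q * b_hi - Y"
    using card_hi by (simp add: Y_def sum_subtractf)
  have Qc: "Q * ?c \<le> Q * b_hi - Y" "Q * ?d \<le> Q * b_lo + E - Z"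
    using Q_card_le lo_sum hi_sum by auto
  have "Q * (b_hi + b_lo - 2) \<le> Q * (?c + ?d)" using total Q_pos by (intro mult_left_mono) auto
  then have YZ: "Y + Z \<le> 2 * Q + E" using Qc by (simp add: algebra_simps)
  then have EZ: "(u - 1) * E + Z \<le> 2 * Q" using EY by (simp add: algebra_simps)
  have "Q * (b_lo - 1) < Q * ?d" using lo_big Q_pos by simp
  then have ZE: "Z < Q + E" using Qc by (simp add: algebra_simps)
  \<comment> \<open>Scaling \<open>ZE\<close> by \<open>u - 1\<close> allows \<open>E\<close> to be
    eliminated with \<open>EZ\<close>.\<close>
  have "(u - 1) * Z < (u - 1) * (Q + E)" using ZE u2 by simp
  then have uZ: "u * Z < (u + 1) * Q" using EZ by (simp add: algebra_simps)
  have Qcap: "Q < u * cap_lo" using cap_lo_gt[OF lt] u2 by (simp add: u_def)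
  have "?z * cap_lo \<le> Z"
  proof -
    have "zeros (k - i) \<inter> lo = zeros (k - i)" by (auto simp: zeros_def lo_def)
    then have "?z * cap_lo = (\<Sum>D\<in>lo. if D \<in> zeros (k - i) then cap_lo else 0)"
      by (simp add: Int_commute flip: sum.inter_restrict)
    also have "\<dots> \<le> Z" unfolding Z_def using caps_ge_1 by (intro sum_mono) (auto simp: zeros_def f_def)
    finally show ?thesis .
  qed
  then have "u * (?z * cap_lo) \<le> u * Z" using u2 by (intro mult_left_mono) auto
  also have "\<dots> < (u + 1) * Q" by (rule uZ)
  also have "\<dots> \<le> (u + 1) * (u * cap_lo)" using Qcap u2 by (intro mult_left_mono) auto
  finally have "(u * cap_lo) * ?z < (u * cap_lo) * (u + 1)" by (simp add: mult_ac)
  then have "?z < u + 1" using u2 caps_ge_1 by (simp add: mult_less_cancel_left)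
  then have "real (card (zeros (k - i))) < real (q ^ i + 1)" by (simp add: u_def)
  \<comment> \<open>By integrality \<open>card (zeros (k - i)) < q ^ i + 1\<close> is the threshold
    of the hyperplane argument.\<close>
  then have z: "card (zeros (k - i)) \<le> q ^ (k - (k - i))" using i_lt by (simp only: of_nat_less_iff) simp
  have sym: "gauss_binomial q (k - 1) (k - i - 1) = cap_lo"
  proof -
    have "k - i - 1 = k - 1 - i" by simp
    then show ?thesis
      unfolding cap_lo_def using gauss_binomial_symmetric[OF q_gt_1, of i "k - 1"] i_lt by simp
  qed
  have ki: "k - (k - i) = i" using i_lt by simp
  from card_index_class_hyperplane[OF Aiso i_lt(2,3) z]
  obtain \<T> where T: "\<T> \<subseteq> lo"
    "real (card \<T>) = real q ^ (k * i) * gauss_binomial q (dim UNIV - k - 1) i"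
    "?d * cap_lo \<le> (\<Sum>D\<in>\<T>. f D)"
    unfolding sym f_def ki lo_def by blast
  have "(\<Sum>D\<in>\<T>. f D) \<le> (\<Sum>D\<in>\<T>. cap_lo + max 0 (f D - cap_lo))"
    by (intro sum_mono) auto
  also have "\<dots> \<le> real (card \<T>) * cap_lo + E"
    unfolding E_def using T(1) by (simp add: sum.distrib sum_mono2)
  finally have "?d * cap_lo \<le> real (card \<T>) * cap_lo + E" using T(3) by linarith
  moreover have "(b_lo - 1) * cap_lo < ?d * cap_lo" using lo_big caps_ge_1 by (intro mult_strict_right_mono) auto
  moreover have "E \<le> 2 * u * cap_lo"
  proof -
    have "1 * E \<le> (u - 1) * E" using u2 E0 by (intro mult_right_mono) auto
    then show ?thesis using EZ Z0 Qcap by linarith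
  qed
  ultimately have "(b_lo - 1 - real (card \<T>)) * cap_lo < (2 * u) * cap_lo" by (simp add: algebra_simps)
  then have "b_lo - 1 - real (card \<T>) < 2 * u" using caps_ge_1 by (simp add: mult_less_cancel_right)
  moreover have "real (card \<T>) + real q ^ (i\<^sup>2) * cap_lo \<le> b_lo"
    unfolding T(2) powers_Q(1) b_lo_def
    using b_ge_hyperplane[of i cap_lo] i i_lt Qcap caps_ge_1 by (simp add: u_def)
  \<comment> \<open>The surplus of the whole space over the hyperplane exceeds what the error
    \<open>E\<close> and the slack \<open>1\<close> permit.\<close>
  moreover have "real q ^ (i\<^sup>2) * cap_lo \<ge> 2 * u + 1"
  proof -
    have "real q ^ (i\<^sup>2) * (real q ^ (i * (k - 1 - i)) + 1) \<le> real q ^ (i\<^sup>2) * cap_lo"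
      unfolding cap_lo_def using lt i by (intro mult_left_mono gauss_binomial_gt_power) auto
    moreover have "real q ^ (i\<^sup>2) * real q ^ (i * (k - 1 - i)) \<ge> u * u"
    proof -
      have "i\<^sup>2 + i * (k - 1 - i) = i * (k - 1)"
        using i_lt by (simp add: power2_eq_square flip: distrib_left)
      moreover have "i * 2 \<le> i * (k - 1)" using lt i by (intro mult_le_mono2) simp
      then have "real q ^ (i * 2) \<le> real q ^ (i * (k - 1))" using q_gt_1 by (intro power_increasing) auto
      moreover have "u * u = real q ^ (i * 2)" by (simp add: u_def power_mult power2_eq_square)
      ultimately show ?thesis by (simp only: power_add[symmetric])
    qed
    moreover have "real q ^ (i\<^sup>2) \<ge> 1" using q_gt_1 by (intro one_le_power) simp
    moreover have "2 * u \<le> u * u" using u2 by (intro mult_right_mono) auto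
    ultimately show ?thesis by (simp add: distrib_left)
  qed
  ultimately show False by linarith
qed

text \<open>The inequality is strict, so the equality clause of the theorem only concerns a
  non-isolated \<open>A\<close>. For \<open>2 * i = k\<close> the two classes coincide and
  \<open>card_hi_less\<close> suffices.\<close>

lemma isolated_bound:
  assumes Aiso: "A \<in> isol"
  shows "real (card (cls i)) + real (card (cls (k - i))) < b_hi + b_lo"
proof -
  have A_cls: "card (cls j) = card (cls j - {A}) + 1" for j
    using Aiso card_Suc_Diff1[of "cls j" A] by (simp add: index_class_def)
  show ?thesis
  proof (cases "2 * i = k")
    case True
    then have ki: "k - i = i" by simp
    then have "b_lo = b_hi" unfolding b_lo_def b_hi_def using caps_eq[OF True] by simp
    then show ?thesis using card_hi_less[OF Aiso] ki A_cls by simp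
  next
    case False
    then have lt: "2 * i < k" using i by simp
    show ?thesis
    proof (cases "b_lo - 1 < real (card (cls (k - i) - {A}))")
      case True
      then show ?thesis using isolated_bound_lt[OF Aiso lt] A_cls by simp
    qed (use card_hi_less[OF Aiso] A_cls in simp)
  qed
qed

end

theorem theorem4p8:
  fixes scale :: "'a::{field,finite} \<Rightarrow> 'b::ab_group_add \<Rightarrow> 'b"
    and F :: "'b set set" and A :: "'b set" and n k i q :: nat
  assumes "vector_space scale"
    and "q = CARD('a)"
    and "vector_space.dim scale (UNIV :: 'b set) = n"
    and "2 \<le> k" and "2 * k \<le> n"
    and "\<forall>B\<in>F. dim_subspace scale k B"
    and "covering_triple_free scale k F"
    and "A \<in> F"
    and "1 \<le> i" and "2 * i \<le> k"
  shows "let Fi = index_class scale F A i;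
             Fki = index_class scale F A (k - i);
             bound = real q ^ ((k - i)\<^sup>2) * gauss_binomial q (n - k) (k - i) * gauss_binomial q (k - 1) (i - 1)
                   + real q ^ (i\<^sup>2) * gauss_binomial q (n - k) i * gauss_binomial q (k - 1) i
         in real (card Fi) + real (card Fki) \<le> bound \<and>
            (real (card Fi) + real (card Fki) = bound \<longrightarrow>
               (\<forall>D. dim_subspace scale i D \<and> D \<inter> A = {0} \<longrightarrow>
                    real (card (phi_inv scale k F A D)) \<ge> gauss_binomial q (k - 1) i) \<and>
               isolated_members F = {} \<and>
               (\<forall>B \<in> Fi \<union> Fki. card (phi scale k F A B) = q ^ (i * (k - i))))"
proof -
  interpret vs: vector_space scale by fact
  obtain Basis where B: "vs.independent Basis" "UNIV \<subseteq> vs.span Basis" "card Basis = vs.dim UNIV"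
    by (metis vs.basis_exists)
  \<comment> \<open>\<open>card\<close> is \<open>0\<close> for infinite sets, so the positive
    dimension \<open>n\<close> guarantees a finite basis.\<close>
  have "card Basis > 0" using B(3) assms(3-5) by simp
  then have "finite Basis" by (rule card_ge_0_finite)
  then interpret covering_triple_free_family_index scale Basis q k F A i
    using assms B by unfold_locales auto
  have lo: "D \<in> lo \<longleftrightarrow> dim_subspace scale i D \<and> D \<inter> A = {0}" for D
    using i_lt i by (auto simp: lo_transversal transversal_def dim_subspace_def)
  have "real (card (cls i)) + real (card (cls (k - i))) \<le> b_hi + b_lo \<and>
      (real (card (cls i)) + real (card (cls (k - i))) = b_hi + b_lo \<longrightarrow>
        (\<forall>D\<in>lo. cap_lo \<le> f D) \<and> isol = {} \<and> (\<forall>B\<in>cls i \<union> cls (k - i). card (Phi B) = q ^ (i * (k - i))))"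
    using nonisolated_bound isolated_bound by (cases "A \<in> isol") auto
  then show ?thesis
    unfolding Let_def b_hi_def b_lo_def cap_hi_def cap_lo_def f_def assms(3) lo Ball_def .
qed

end
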